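(* Let $p>q\ge 0$ and $d\ge1$ be integers, and let $Y=(Y_t)_{t\in\mathbb{R}}$ be the $d$-dimensional MCARMA process with autoregressive polynomial $P(z)=I_dz^p+A_1z^{p-1}+\dots+A_p$ and moving average polynomial $Q(z)=B_0z^q+\dots+B_q$, where all zeros of $\det P$ have negative real part. For $\Delta>0$ let $f_\Delta$ be the spectral density matrix of the sampled process $(Y_{n\Delta})_{n\in\mathbb{Z}}$. Assume that the zeros $\lambda_1,\dots,\lambda_{pd}$ of $\det P(z)$ are pairwise different, i.e. each has multiplicity one. Then for all $\Delta>0$ and $\omega\in(-\pi,\pi)$ $$f_\Delta(\omega)=\frac1{4\pi}\sum_{\ell=1}^{pd}\frac{e^{-\mathfrak{i}\omega}\bigl(\alpha(\ell)-\alpha(\ell)^\top\bigr)-e^{\Delta\lambda_\ell}\alpha(\ell)+e^{-\Delta\lambda_\ell}\alpha(\ell)^\top}{\cosh\Delta\lambda_\ell-\cos\omega},$$ where the coefficient matrices $\alpha(\ell)\in\mathbb{C}^{d\times d}$ come from the partial fraction decomposition $$R(z)=\sum_{\ell=1}^{pd}\left(\frac{\alpha(\ell)}{z-\lambda_\ell}+\frac{\beta(\ell)}{-z-\lambda_\ell}\right).$$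
   Context: $A_i,B_j$ are real $d\times d$ matrices; $I_d$ is the identity matrix; $\mathfrak{i}$ is the imaginary unit; $^\top$ is the (non-conjugate) transpose. Driving process: $L=(L_t)_{t\in\mathbb{R}}$ is a two-sided $d$-dimensional Lévy process, $L_t=L_1(t)$ for $t\ge0$, $L_t=-L_2(-t-)$ for $t<0$, with $L_1,L_2$ i.i.d. one-sided Lévy processes, $\mathbf{E}L_1(1)=0$, $\mathbf{E}\|L_1(1)\|^2<\infty$, and $\Sigma_L$ is the covariance matrix of $L_1(1)$. MCARMA process: $Y_t=\int_{-\infty}^t g(t-s)\,\mathrm{d}L_s$ (in the $L^2$ sense), with $g(t)=\frac1{2\pi}\int_{-\infty}^{\infty}e^{\mathfrak{i}tx}P(\mathfrak{i}x)^{-1}Q(\mathfrak{i}x)\,\mathrm{d}x$ (inverse Fourier transform in the $L^2$ sense; $g$ vanishes on the negative half-line). Its spectral density is $f_Y(\lambda)=\frac1{2\pi}P(\mathfrak{i}\lambda)^{-1}Q(\mathfrak{i}\lambda)\Sigma_LQ(\mathfrak{i}\lambda)^*(P(\mathfrak{i}\lambda)^{-1})^*$, where $*$ is the conjugate transpose, so that $\Gamma(t):=\mathbf{E}[Y_tY_0^\top]=\int_{\mathbb{R}}e^{\mathfrak{i}t\lambda}f_Y(\lambda)\,\mathrm{d}\lambda$. Spectral density of the sampled process: $f_\Delta(\omega)=\frac1{2\pi}\sum_{k\in\mathbb{Z}}e^{-\mathfrak{i}k\omega}\Gamma(k\Delta)$. $R(z)=P(z)^{-1}Q(z)\,\Sigma_L\,Q(-z)^\top(P(-z)^{-1})^\top=\dfrac{S(z)}{\det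 P(z)\det P(-z)}$, with the matrix polynomial $S(z)=\mathrm{adj}P(z)\,Q(z)\,\Sigma_L\,(\mathrm{adj}P(-z)\,Q(-z))^\top$, where $\mathrm{adj}$ is the adjugate. *)

theory Defs
  imports "HOL-Probability.Probability"
begin

definition mat_scale :: "'a::times \<Rightarrow> 'a^'n^'m \<Rightarrow> 'a^'n^'m" (infixr "*\<^sub>M" 75)
  where "c *\<^sub>M A = (\<chi> i j. c * A $ i $ j)"

abbreviation cmat :: "real^'n^'m \<Rightarrow> complex^'n^'m"
  where "cmat \<equiv> map_matrix complex_of_real"

text \<open>All paths (not just almost all) are required to be right continuous with left limits,
  which is the usual choice of a version; \<^term>\<open>two_sided\<close> below uses the left limits.\<close>

definition levy_process :: "'w measure \<Rightarrow> (real \<Rightarrow> 'w \<Rightarrow> 'a::euclidean_space) \<Rightarrow> bool"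
  where "levy_process M X \<longleftrightarrow>
    (\<forall>t\<ge>0. X t \<in> borel_measurable M) \<and>
    (AE w in M. X 0 w = 0) \<and>
    (\<forall>n t. 0 \<le> t 0 \<and> (\<forall>i<n. t i \<le> t (Suc i)) \<longrightarrow>
       prob_space.indep_vars M (\<lambda>_. borel) (\<lambda>i w. X (t (Suc i)) w - X (t i) w) {..<(n::nat)}) \<and>
    (\<forall>s\<ge>0. \<forall>h\<ge>0. distr M borel (\<lambda>w. X (s + h) w - X s w) = distr M borel (X h)) \<and>
    (\<forall>t\<ge>0. \<forall>\<epsilon>>0.
       ((\<lambda>s. measure M {w \<in> space M. norm (X s w - X t w) > \<epsilon>}) \<longlongrightarrow> 0) (at t within {0..})) \<and>
    (\<forall>w\<in>space M. \<forall>t\<ge>0. continuous (at_right t) (\<lambda>s. X s w)) \<and>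
    (\<forall>w\<in>space M. \<forall>t>0. \<exists>l. ((\<lambda>s. X s w) \<longlongrightarrow> l) (at_left t))"

text \<open>Independence and equality in law of two processes, as random elements of the path space
  with its product \<open>\<sigma>\<close>-algebra.\<close>

definition iid_processes ::
  "'w measure \<Rightarrow> (real \<Rightarrow> 'w \<Rightarrow> 'a::euclidean_space) \<Rightarrow> (real \<Rightarrow> 'w \<Rightarrow> 'a) \<Rightarrow> bool"
  where "iid_processes M X X' \<longleftrightarrow>
    (let S = (\<Pi>\<^sub>M t\<in>{0..}. borel); path = (\<lambda>Z w. \<lambda>t\<in>{0..}. Z t w) in
      prob_space.indep_var M S (path X) S (path X') \<and>
      distr M S (path X) = distr M S (path X'))"

definition two_sided ::
  "(real \<Rightarrow> 'w \<Rightarrow> 'a::euclidean_space) \<Rightarrow> (real \<Rightarrow> 'w \<Rightarrow> 'a) \<Rightarrow> real \<Rightarrow> 'w \<Rightarrow> 'a"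
  where "two_sided X X' t w =
    (if t \<ge> 0 then X t w else - Lim (at_left (- t)) (\<lambda>s. X' s w))"

definition covariance_matrix :: "'w measure \<Rightarrow> ('w \<Rightarrow> real^'n) \<Rightarrow> real^'n^'n"
  where "covariance_matrix M Z = (\<chi> i j. \<integral>w.
    (Z w $ i - (\<integral>v. Z v $ i \<partial>M)) * (Z w $ j - (\<integral>v. Z v $ j \<partial>M)) \<partial>M)"

text \<open>A step function is a list of triples \<open>(a, b, C)\<close>, each standing for the matrix \<open>C\<close> on the
  interval \<open>(a, b]\<close>.\<close>

definition step_kernel :: "(real \<times> real \<times> (real^'n^'m)) list \<Rightarrow> real \<Rightarrow> real^'n^'m"
  where "step_kernel xs s = (\<Sum>(a, b, C) \<leftarrow> xs. indicat_real {a<..b} s *\<^sub>R C)"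

definition step_integral ::
  "(real \<Rightarrow> 'w \<Rightarrow> real^'n) \<Rightarrow> (real \<times> real \<times> (real^'n^'m)) list \<Rightarrow> 'w \<Rightarrow> real^'m"
  where "step_integral L xs w = (\<Sum>(a, b, C) \<leftarrow> xs. C *v (L b w - L a w))"

text \<open>\<open>Z\<close> is a version of \<open>\<integral> h(s) dL\<^sub>s\<close>: the \<open>L\<^sup>2(M)\<close> limit of the integrals of step functions
  that tend to \<open>h\<close> in \<open>L\<^sup>2(\<real>)\<close>. Nonnegative integrals are used, so that convergence to \<open>0\<close> includes
  square integrability of the differences.\<close>

definition has_L2_integral ::
  "'w measure \<Rightarrow> (real \<Rightarrow> 'w \<Rightarrow> real^'n) \<Rightarrow> (real \<Rightarrow> real^'n^'m) \<Rightarrow> ('w \<Rightarrow> real^'m) \<Rightarrow> bool"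
  where "has_L2_integral M L h Z \<longleftrightarrow>
    h \<in> borel_measurable borel \<and> Z \<in> borel_measurable M \<and>
    (\<exists>xs :: nat \<Rightarrow> (real \<times> real \<times> (real^'n^'m)) list.
      (\<forall>n. \<forall>(a, b, C) \<in> set (xs n). a \<le> b) \<and>
      (\<lambda>n. \<integral>\<^sup>+ s. ennreal ((norm (step_kernel (xs n) s - h s))\<^sup>2) \<partial>lborel) \<longlonglongrightarrow> 0 \<and>
      (\<lambda>n. \<integral>\<^sup>+ w. ennreal ((norm (step_integral L (xs n) w - Z w))\<^sup>2) \<partial>M) \<longlonglongrightarrow> 0)"

text \<open>\<open>g\<close> is a version of \<open>(1/2\<pi>) \<integral> e\<^sup>i\<^sup>t\<^sup>x F(x) dx\<close>, the integrals truncated to \<open>[-N, N]\<close> converging in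
  \<open>L\<^sup>2(\<real>)\<close>. The integral over the whole line need not exist as a Lebesgue integral.\<close>

definition L2_inverse_fourier ::
  "(real \<Rightarrow> complex^'n^'m) \<Rightarrow> (real \<Rightarrow> complex^'n^'m) \<Rightarrow> bool"
  where "L2_inverse_fourier F g \<longleftrightarrow>
    g \<in> borel_measurable borel \<and>
    ((\<lambda>N. \<integral>\<^sup>+ t. ennreal ((norm (
        (1 / (2 * pi)) *\<^sub>R (LINT x:{-N..N}|lborel. exp (\<i> * complex_of_real (t * x)) *\<^sub>M F x)
        - g t))\<^sup>2) \<partial>lborel) \<longlongrightarrow> 0) at_top"

definition ar_poly :: "nat \<Rightarrow> (nat \<Rightarrow> real^'d^'d) \<Rightarrow> complex \<Rightarrow> complex^'d^'d"
  where "ar_poly p A z = z ^ p *\<^sub>M mat 1 + (\<Sum>k = 1..p. z ^ (p - k) *\<^sub>M cmat (A k))"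

definition ma_poly :: "nat \<Rightarrow> (nat \<Rightarrow> real^'d^'d) \<Rightarrow> complex \<Rightarrow> complex^'d^'d"
  where "ma_poly q B z = (\<Sum>k = 0..q. z ^ (q - k) *\<^sub>M cmat (B k))"

text \<open>The kernel is real valued because the coefficients of \<open>P\<close> and \<open>Q\<close> are real.\<close>

definition mcarma_kernel ::
  "(complex \<Rightarrow> complex^'d^'d) \<Rightarrow> (complex \<Rightarrow> complex^'d^'d) \<Rightarrow> (real \<Rightarrow> real^'d^'d) \<Rightarrow> bool"
  where "mcarma_kernel P Q g \<longleftrightarrow>
    L2_inverse_fourier
      (\<lambda>x. matrix_inv (P (\<i> * complex_of_real x)) ** Q (\<i> * complex_of_real x))
      (\<lambda>t. cmat (g t))"

definition mcarma_process ::
  "'w measure \<Rightarrow> (real \<Rightarrow> 'w \<Rightarrow> real^'d) \<Rightarrow> (complex \<Rightarrow> complex^'d^'d) \<Rightarrow>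
   (complex \<Rightarrow> complex^'d^'d) \<Rightarrow> (real \<Rightarrow> 'w \<Rightarrow> real^'d) \<Rightarrow> bool"
  where "mcarma_process M L P Q Y \<longleftrightarrow>
    (\<exists>g. mcarma_kernel P Q g \<and>
      (\<forall>t. has_L2_integral M L (\<lambda>s. indicat_real {..t} s *\<^sub>R g (t - s)) (Y t)))"

definition autocov :: "'w measure \<Rightarrow> (real \<Rightarrow> 'w \<Rightarrow> real^'d) \<Rightarrow> real \<Rightarrow> real^'d^'d"
  where "autocov M Y t = (\<chi> i j. \<integral>w. Y t w $ i * Y 0 w $ j \<partial>M)"

definition sampled_spectral_density ::
  "'w measure \<Rightarrow> (real \<Rightarrow> 'w \<Rightarrow> real^'d) \<Rightarrow> real \<Rightarrow> real \<Rightarrow> complex^'d^'d"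
  where "sampled_spectral_density M Y \<Delta> \<omega> =
    complex_of_real (1 / (2 * pi)) *\<^sub>M
    (\<Sum>\<^sub>\<infinity>k::int. exp (- \<i> * of_int k * complex_of_real \<omega>) *\<^sub>M cmat (autocov M Y (of_int k * \<Delta>)))"

definition R_fun ::
  "(complex \<Rightarrow> complex^'d^'d) \<Rightarrow> (complex \<Rightarrow> complex^'d^'d) \<Rightarrow> real^'d^'d \<Rightarrow> complex \<Rightarrow> complex^'d^'d"
  where "R_fun P Q \<Sigma> z =
    matrix_inv (P z) ** Q z ** cmat \<Sigma> ** transpose (Q (- z)) ** transpose (matrix_inv (P (- z)))"

text \<open>The identity is required away from the poles of the right hand side, where \<^const>\<open>matrix_inv\<close>
  is the inverse.\<close>

definition partial_fractions ::
  "(complex \<Rightarrow> complex^'d^'d) \<Rightarrow> (complex \<Rightarrow> complex^'d^'d) \<Rightarrow> real^'d^'d \<Rightarrow> nat \<Rightarrow>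
   (nat \<Rightarrow> complex) \<Rightarrow> (nat \<Rightarrow> complex^'d^'d) \<Rightarrow> (nat \<Rightarrow> complex^'d^'d) \<Rightarrow> bool"
  where "partial_fractions P Q \<Sigma> n lam \<alpha> \<beta> \<longleftrightarrow>
    (\<forall>z. det (P z) \<noteq> 0 \<and> det (P (- z)) \<noteq> 0 \<longrightarrow>
      R_fun P Q \<Sigma> z =
        (\<Sum>l = 1..n. (1 / (z - lam l)) *\<^sub>M \<alpha> l + (1 / (- z - lam l)) *\<^sub>M \<beta> l))"

end

theory Submission
  imports Defs
begin

text \<open>By Cramer's rule the entries of \<open>P(z)\<^sup>-\<^sup>1Q(z)\<close> are proper rational functions with simple poles,
  so \<open>P(z)\<^sup>-\<^sup>1Q(z) = \<Sum>\<rho>(l)/(z - \<lambda>(l))\<close>. Multiplying the two factors of \<open>R\<close> gives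
  \<open>\<alpha>(l) = \<Sum>\<^sub>m \<rho>(l) \<Sigma> \<rho>(m)\<^sup>T / (- \<lambda>(l) - \<lambda>(m))\<close>. On the probabilistic side the kernel is
  \<open>g(t) = \<Sum> exp(\<lambda>(l)t) \<rho>(l)\<close> for \<open>t > 0\<close>, and the isometry of the integral with respect to the Levy process
  gives \<open>\<Gamma>(t) = \<integral>g(t + u) \<Sigma> g(u)\<^sup>T du = \<Sum> exp(\<lambda>(l)t) \<alpha>(l)\<close> for \<open>t \<ge> 0\<close>. As \<open>\<Gamma>(-t)\<close> is the transpose
  of \<open>\<Gamma>(t)\<close>, the series for \<open>f\<^sub>\<Delta>\<close> is a sum of two-sided geometric series. Its value differs from the
  stated one by a multiple of \<open>\<Sum>(\<alpha>(l) - \<alpha>(l)\<^sup>T) = \<Gamma>(0) - \<Gamma>(0)\<^sup>T = 0\<close>.\<close>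

section \<open>Partial fractions\<close>

text \<open>The kernel is given only as an \<open>L^2\<close> limit: for \<open>q = p - 1\<close>
  the transform may decay like \<open>1/x\<close>, so the inverse Fourier integral need not converge
  absolutely. Hence the truncated integral of a single simple pole is computed explicitly, and an
  integration by parts replaces the Dirichlet kernel, which has no integrable majorant uniform in
  the cutoff, by the bounded sine integral. The Levy process has second moments by assumption at
  time 1 only, while the isometry needs covariances of all increments. Independence of increments
  carries square integrability back to earlier times, and locally bounded additive functions of time
  are linear. At negative times the driving process is built from left limits, which agree with the
  values almost surely by continuity in mean square. The formula is claimed for every decomposition
  of \<open>R\<close>. Each \<alpha>(l) is the limit of \<open>(z - lam l) R(z)\<close> at
  \<open>lam l\<close>, so treating one decomposition suffices. Its denominators arise twice, from
  splitting products of poles and from integrating \<open>exp((lam l + lam m) u)\<close> over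
  \<open>u > 0\<close>; this is why the same matrices govern the autocovariance.\<close>

lemma degree_linear_prod: "degree (\<Prod>m\<in>S. [:- f m, 1 :: complex:]) = card S"
  by (subst degree_prod_eq_sum_degree) auto

text \<open>The \<open>n\<close> distinct roots determine \<open>D\<close> up to the constant
  \<open>c\<close>, and \<open>N\<close>, having degree below \<open>n\<close>, is its own Lagrange
  interpolation polynomial at them. Dividing the interpolation formula by \<open>D\<close> gives
  \<open>r l = N(lam l) / D'(lam l)\<close>, since \<open>c\<close> times the value of
  \<open>E' l\<close> at \<open>lam l\<close> is the derivative of \<open>D\<close> there.\<close>

lemma partial_fraction_simple_roots:
  fixes N D :: "complex poly" and lam :: "nat \<Rightarrow> complex"
  assumes N: "degree N < n" and D: "degree D \<le> n" "D \<noteq> 0"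
    and inj: "inj_on lam {1..n}" and root: "\<And>l. l \<in> {1..n} \<Longrightarrow> poly D (lam l) = 0"
  obtains r where "\<And>z. poly D z \<noteq> 0 \<Longrightarrow> poly N z / poly D z = (\<Sum>l=1..n. r l / (z - lam l))"
proof -
  define E where "E = (\<Prod>m\<in>{1..n}. [:- lam m, 1:])"
  define E' where "E' = (\<lambda>l. \<Prod>m\<in>{1..n}-{l}. [:- lam m, 1:])"
  have card: "card (lam ` {1..n}) = n" using inj by (simp add: card_image)
  have degE: "degree E = n" by (simp add: E_def degree_linear_prod)
  have lcE: "coeff E n = 1"
    using degE lead_coeff_prod[of "\<lambda>m. [:- lam m, 1:]" "{1..n}"] by (simp add: E_def)
  have degE': "degree (E' l) < n" if "l \<in> {1..n}" for l
    using that by (simp add: E'_def degree_linear_prod)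
  define c where "c = coeff D n"
  \<comment> \<open>Both sides have degree at most \<open>n\<close> and the same coefficient of
    order \<open>n\<close>, so their difference has degree below \<open>n\<close> and vanishes once
    it vanishes at the \<open>n\<close> roots.\<close>
  have DE: "D = smult c E"
  proof (rule poly_eqI_degree_lead_coeff[of _ n _ "lam ` {1..n}"])
    fix x assume "x \<in> lam ` {1..n}"
    then obtain k where "k \<in> {1..n}" "x = lam k" by auto
    moreover from this have "poly E x = 0" by (auto simp: E_def poly_prod intro!: prod_zero)
    ultimately show "poly D x = poly (smult c E) x" using root by simp
  qed (use D degE lcE card in \<open>auto simp: c_def\<close>)
  have c0: "c \<noteq> 0" using DE D by auto
  define a where "a = (\<lambda>l. poly N (lam l) / poly (E' l) (lam l))"
  have E'0: "poly (E' l) (lam l) \<noteq> 0" if "l \<in> {1..n}" for l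
  proof -
    have "lam l \<noteq> lam m" if "m \<in> {1..n} - {l}" for m
      using inj that \<open>l \<in> {1..n}\<close> by (metis DiffE inj_onD insertI1)
    then show ?thesis by (simp add: E'_def poly_prod)
  qed
  have NE: "N = (\<Sum>l\<in>{1..n}. smult (a l) (E' l))"
  proof (rule poly_eqI_degree[of "lam ` {1..n}"])
    fix x assume "x \<in> lam ` {1..n}"
    then obtain k where k: "k \<in> {1..n}" "x = lam k" by auto
    have "poly (E' l) (lam k) = 0" if "l \<in> {1..n}" "l \<noteq> k" for l
      unfolding E'_def poly_prod using k that by (intro prod_zero bexI[of _ k]) simp_all
    then have "(\<Sum>l=1..n. a l * poly (E' l) (lam k)) = (\<Sum>l\<in>{k}. a l * poly (E' l) (lam k))"
      using k by (intro sum.mono_neutral_right) auto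
    also have "\<dots> = poly N (lam k)" using E'0[OF k(1)] by (simp add: a_def)
    finally show "poly N x = poly (\<Sum>l\<in>{1..n}. smult (a l) (E' l)) x"
      unfolding k(2) poly_sum poly_smult by (rule sym)
  next
    show "degree (\<Sum>l\<in>{1..n}. smult (a l) (E' l)) < card (lam ` {1..n})"
      unfolding card
    proof (rule degree_sum_less)
      show "degree (smult (a l) (E' l)) < n" if "l \<in> {1..n}" for l
        using degE'[OF that] degree_smult_le[of "a l" "E' l"] by linarith
    qed (use N in simp)
    show "degree N < card (lam ` {1..n})" using N card by simp
  qed
  show ?thesis
  proof (rule that[of "\<lambda>l. a l / c"])
    fix z assume z: "poly D z \<noteq> 0"
    have zl: "z \<noteq> lam l" if "l \<in> {1..n}" for l using root[OF that] z by auto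
    have E: "poly E z = (z - lam l) * poly (E' l) z" if "l \<in> {1..n}" for l
      using prod.remove[of "{1..n}" l "\<lambda>m. z - lam m"] that by (simp add: E_def E'_def poly_prod)
    have E0: "poly E z \<noteq> 0" using z DE by auto
    have "poly N z / poly D z = (\<Sum>l=1..n. a l * poly (E' l) z / (c * poly E z))"
      by (subst NE, subst DE) (simp add: poly_sum sum_divide_distrib)
    also have "\<dots> = (\<Sum>l=1..n. a l / c / (z - lam l))"
    proof (rule sum.cong[OF refl])
      fix l assume l: "l \<in> {1..n}"
      have "poly (E' l) z \<noteq> 0" using E[OF l] E0 by auto
      then show "a l * poly (E' l) z / (c * poly E z) = a l / c / (z - lam l)"
        using c0 zl[OF l] by (simp add: E[OF l] divide_simps)
    qed
    finally show "poly N z / poly D z = (\<Sum>l=1..n. a l / c / (z - lam l))" .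
  qed
qed

lemma poly_det:
  fixes M :: "'a::comm_ring_1 poly^'d^'d"
  shows "poly (det M) z = det (\<chi> i j. poly (M $ i $ j) z)"
  by (simp add: det_def poly_sum poly_prod)

text \<open>Every Leibniz term takes exactly one entry from each column, so column bounds add up.
  Letting the bound vary with the column is what shows that the degree drops when one column is
  replaced by a column of lower degree.\<close>

lemma degree_det_le:
  fixes M :: "'a::comm_ring_1 poly^'d^'d"
  assumes "\<And>i j. degree (M $ i $ j) \<le> f j"
  shows "degree (det M) \<le> sum f UNIV"
  unfolding det_def
proof (rule degree_sum_le)
  fix p :: "'d \<Rightarrow> 'd" assume "p \<in> {p. p permutes UNIV}"
  then have p: "p permutes UNIV" by simp
  have "degree (of_int (sign p) * (\<Prod>i\<in>UNIV. M $ i $ p i)) \<le> degree (\<Prod>i\<in>UNIV. M $ i $ p i)"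
    by (rule order_trans[OF degree_mult_le]) simp
  also have "\<dots> \<le> (\<Sum>i\<in>UNIV. degree (M $ i $ p i))"
    using degree_prod_sum_le[of UNIV "\<lambda>i. M $ i $ p i"] by (simp add: comp_def)
  also have "\<dots> \<le> (\<Sum>i\<in>UNIV. f (p i))" by (intro sum_mono assms)
  also have "\<dots> = sum f UNIV"
    using sum.permute[OF p, of f] by (simp add: comp_def)
  finally show "degree (of_int (sign p) * (\<Prod>i\<in>UNIV. M $ i $ p i)) \<le> sum f UNIV" .
qed (simp add: finite_permutations)

lemma matrix_mult_matrix_inv: "invertible A \<Longrightarrow> A ** matrix_inv A = mat 1"
  unfolding invertible_def matrix_inv_def by (rule someI_ex[THEN conjunct1])

text \<open>Column \<open>j\<close> of the product solves the linear system with matrix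
  \<open>A\<close> and right-hand side column \<open>j\<close> of \<open>B\<close>, so this is
  Cramer's rule. For polynomial matrices it exhibits each entry as a quotient of polynomials with
  common denominator \<open>det A\<close>.\<close>

lemma matrix_inv_mult_nth:
  fixes A B :: "'a::field^'n^'n"
  assumes A: "det A \<noteq> 0"
  shows "(matrix_inv A ** B) $ i $ j = det (\<chi> k l. if l = i then B $ k $ j else A $ k $ l) / det A"
proof -
  have "A ** (matrix_inv A ** B) = B"
    using A by (simp add: matrix_mul_assoc matrix_mult_matrix_inv invertible_det_nz)
  moreover have "A *v column j C = column j (A ** C)" for C
    by (simp add: vec_eq_iff column_def matrix_vector_mult_def matrix_matrix_mult_def)
  ultimately have "A *v column j (matrix_inv A ** B) = column j B"
    by simp
  then have "column j (matrix_inv A ** B) =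
      (\<chi> k. det (\<chi> i l. if l = k then column j B $ i else A $ i $ l) / det A)"
    using cramer[OF A] by blast
  then have "column j (matrix_inv A ** B) $ i =
      det (\<chi> k l. if l = i then column j B $ k else A $ k $ l) / det A"
    by simp
  then show ?thesis by (simp add: column_def cong: if_cong)
qed


lemma ar_poly_nth: "ar_poly p A z $ i $ j =
    poly (monom (mat 1 $ i $ j) p + (\<Sum>k=1..p. monom (of_real (A k $ i $ j)) (p - k))) z"
  by (simp add: ar_poly_def mat_scale_def poly_sum poly_monom mult.commute)

lemma ma_poly_nth: "ma_poly q B z $ i $ j = poly (\<Sum>k=0..q. monom (of_real (B k $ i $ j)) (q - k)) z"
  by (simp add: ma_poly_def mat_scale_def poly_sum poly_monom mult.commute)

text \<open>The determinant has degree at most \<open>p * CARD('d)\<close> and, by the bijection,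
  that many distinct zeros, so the scalar decomposition applies to every entry with the same poles;
  the matrices \<rho> collect the scalar residues.\<close>

lemma mcarma_partial_fractions:
  fixes A B :: "nat \<Rightarrow> real^'d^'d"
  assumes "q < p" and lam: "bij_betw lam {1..p * CARD('d)} {z. det (ar_poly p A z) = 0}"
  obtains \<rho> where "\<And>z. det (ar_poly p A z) \<noteq> 0 \<Longrightarrow>
    matrix_inv (ar_poly p A z) ** ma_poly q B z = (\<Sum>l=1..p * CARD('d). (1 / (z - lam l)) *\<^sub>M \<rho> l)"
proof -
  let ?n = "p * CARD('d)"
  define a where "a = (\<lambda>i j. monom (mat 1 $ i $ j) p + (\<Sum>k=1..p. monom (complex_of_real (A k $ i $ j)) (p - k)))"
  define b where "b = (\<lambda>i j. \<Sum>k=0..q. monom (complex_of_real (B k $ i $ j)) (q - k))"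
  define D where "D = det (\<chi> i j::'d. a i j)"
  define N where "N = (\<lambda>i j::'d. det (\<chi> k l. if l = i then b k j else a k l))"
  have dega: "degree (a i j) \<le> p" for i j
    unfolding a_def
    by (intro degree_add_le degree_sum_le order_trans[OF degree_monom_le]) auto
  have degb: "degree (b i j) \<le> q" for i j
    unfolding b_def by (intro degree_sum_le order_trans[OF degree_monom_le]) auto
  have polyD: "poly D z = det (ar_poly p A z)" for z
    unfolding D_def poly_det by (rule arg_cong[of _ _ det]) (simp add: vec_eq_iff ar_poly_nth a_def)
  have polyN: "poly (N i j) z = det (\<chi> k l. if l = i then ma_poly q B z $ k $ j else ar_poly p A z $ k $ l)" for i j z
    unfolding N_def poly_det
    by (rule arg_cong[of _ _ det]) (simp add: vec_eq_iff ar_poly_nth ma_poly_nth a_def b_def)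
  have degD: "degree D \<le> ?n"
    using degree_det_le[of "\<chi> i j. a i j" "\<lambda>_. p"] dega by (simp add: D_def mult.commute)
  have degN: "degree (N i j) < ?n" for i j
  proof -
    \<comment> \<open>Cramer's numerator has one column of degree at most \<open>q\<close> in place
      of one of degree at most \<open>p\<close>. This is where \<open>q < p\<close> makes the
      quotient proper, so that no polynomial part occurs.\<close>
    have "degree (N i j) \<le> (\<Sum>l\<in>UNIV. if l = i then q else p)"
      unfolding N_def using dega degb by (intro degree_det_le) auto
    also have "\<dots> < (\<Sum>l\<in>(UNIV::'d set). p)"
      using \<open>q < p\<close> by (intro sum_strict_mono_ex1) auto
    finally show ?thesis by (simp add: mult.commute)
  qed
  \<comment> \<open>\<open>D\<close> is nonzero because its zero set is finite; this avoids
    computing the leading coefficient of the determinant.\<close>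
  have "finite {z. poly D z = 0}"
    using lam unfolding polyD by (metis bij_betw_finite finite_atLeastAtMost)
  then have D0: "D \<noteq> 0" by (auto simp: infinite_UNIV_char_0)
  have "\<exists>r. \<forall>z. poly D z \<noteq> 0 \<longrightarrow> poly (N i j) z / poly D z = (\<Sum>l=1..?n. r l / (z - lam l))" for i j
  proof -
    have "inj_on lam {1..?n}" "\<And>l. l \<in> {1..?n} \<Longrightarrow> poly D (lam l) = 0"
      using lam unfolding polyD by (auto simp: bij_betw_def)
    from partial_fraction_simple_roots[OF degN degD D0 this] show ?thesis by metis
  qed
  then obtain r where r: "\<And>i j z. poly D z \<noteq> 0 \<Longrightarrow>
      poly (N i j) z / poly D z = (\<Sum>l=1..?n. r i j l / (z - lam l))"
    by metis
  show ?thesis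
  proof (rule that[of "\<lambda>l. \<chi> i j. r i j l"])
    fix z assume z: "det (ar_poly p A z) \<noteq> 0"
    show "matrix_inv (ar_poly p A z) ** ma_poly q B z =
        (\<Sum>l=1..?n. (1 / (z - lam l)) *\<^sub>M (\<chi> i j. r i j l))"
      using z r[of z] by (simp add: vec_eq_iff matrix_inv_mult_nth polyN polyD mat_scale_def)
  qed
qed

section \<open>Matrix algebra and the residues of \<open>R\<close>\<close>

lemma matrix_mult_sum_left:
  fixes f :: "'i \<Rightarrow> 'a::semiring_1^'n^'m"
  shows "sum f I ** A = (\<Sum>i\<in>I. f i ** A)"
  by (induction I rule: infinite_finite_induct) (simp_all add: vec_eq_iff matrix_matrix_mult_def sum.distrib distrib_right)

lemma matrix_mult_sum_right:
  fixes f :: "'i \<Rightarrow> 'a::semiring_1^'n^'m"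
  shows "A ** sum f I = (\<Sum>i\<in>I. A ** f i)"
  by (induction I rule: infinite_finite_induct) (simp_all add: matrix_add_ldistrib)

lemma transpose_sum: "transpose (sum f I) = (\<Sum>i\<in>I. transpose (f i))"
  by (simp add: transpose_def vec_eq_iff)

lemma mat_scale_mult_left: "(c *\<^sub>M A) ** B = c *\<^sub>M (A ** (B :: 'a::comm_semiring_1^'n^'m))"
  by (simp add: mat_scale_def matrix_matrix_mult_def sum_distrib_left mult.assoc)

lemma mat_scale_mult_right: "A ** (c *\<^sub>M B) = c *\<^sub>M (A ** (B :: 'a::comm_semiring_1^'n^'m))"
  by (simp add: mat_scale_def matrix_matrix_mult_def sum_distrib_left mult.left_commute)

lemma transpose_mat_scale: "transpose (c *\<^sub>M A) = c *\<^sub>M transpose A"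
  by (simp add: mat_scale_def transpose_def)

lemma mat_scale_mat_scale: "c *\<^sub>M d *\<^sub>M A = (c * d :: 'a::semigroup_mult) *\<^sub>M A"
  by (simp add: mat_scale_def mult.assoc)

lemma mat_scale_sum: "c *\<^sub>M sum f I = (\<Sum>i\<in>I. (c :: 'a::semiring_0) *\<^sub>M f i)"
  by (simp add: mat_scale_def vec_eq_iff sum_distrib_left)

lemma sandwich_nth:
  fixes A B S :: "'a::comm_semiring_1^'n^'n"
  shows "(A ** S ** transpose B) $ i $ j = (\<Sum>k\<in>UNIV. \<Sum>l\<in>UNIV. A $ i $ k * S $ k $ l * B $ j $ l)"
  unfolding matrix_matrix_mult_def transpose_def vec_lambda_beta sum_distrib_right
  by (rule sum.swap)

text \<open>If \<rho> are the residues of \<open>P^-1 Q\<close>, this is \<open>\<rho> l\<close>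
  times \<open>\<Sigma>\<close> times the transpose of \<open>P(- lam l)^-1 Q(- lam l)\<close>, that
  is, the residue of \<open>R\<close> at \<open>lam l\<close>. The expanded form is kept because it
  is also what the correlation integral of the kernel produces.\<close>

definition spectral_residue ::
  "(nat \<Rightarrow> complex) \<Rightarrow> nat \<Rightarrow> (nat \<Rightarrow> complex^'d^'d) \<Rightarrow> real^'d^'d \<Rightarrow> nat \<Rightarrow> complex^'d^'d"
  where "spectral_residue lam n \<rho> \<Sigma> l =
    (\<Sum>m=1..n. (1 / (- lam l - lam m)) *\<^sub>M (\<rho> l ** cmat \<Sigma> ** transpose (\<rho> m)))"

text \<open>A product of a pole at \<open>lam l\<close> and a pole at \<open>- lam m\<close> splits
  into two simple fractions, because stability places the two poles in opposite half-planes.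
  Collecting by \<open>l\<close> gives the first family of coefficients, collecting by
  \<open>m\<close> the second.\<close>

lemma partial_fractions_spectral_residue:
  assumes PQ: "\<And>z. det (P z) \<noteq> 0 \<Longrightarrow> matrix_inv (P z) ** Q z = (\<Sum>l=1..n. (1 / (z - lam l)) *\<^sub>M \<rho> l)"
    and zero: "\<And>l. l \<in> {1..n} \<Longrightarrow> det (P (lam l)) = 0"
    and neg: "\<And>l. l \<in> {1..n} \<Longrightarrow> Re (lam l) < 0"
  shows "partial_fractions P Q \<Sigma> n lam (spectral_residue lam n \<rho> \<Sigma>)
    (\<lambda>m. \<Sum>l=1..n. (1 / (- lam l - lam m)) *\<^sub>M (\<rho> l ** cmat \<Sigma> ** transpose (\<rho> m)))"
  unfolding partial_fractions_def
proof (intro allI impI, elim conjE)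
  fix z assume z: "det (P z) \<noteq> 0" "det (P (- z)) \<noteq> 0"
  let ?T = "\<lambda>l m. \<rho> l ** cmat \<Sigma> ** transpose (\<rho> m)"
  \<comment> \<open>The identity \<open>1/(u v) = (1/u + 1/v) / (u + v)\<close> with
    \<open>u = z - lam l\<close> and \<open>v = - z - lam m\<close>; the variable cancels in
    \<open>u + v = - lam l - lam m\<close>.\<close>
  have frac: "(1 / (z - lam l)) * (1 / (- z - lam m)) =
      1 / (z - lam l) * (1 / (- lam l - lam m)) + 1 / (- z - lam m) * (1 / (- lam l - lam m))"
    if "l \<in> {1..n}" "m \<in> {1..n}" for l m
  proof -
    have "z - lam l \<noteq> 0" "- z - lam m \<noteq> 0" using zero z that by auto
    moreover have "- lam l - lam m \<noteq> 0"
    proof -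
      have "Re (- lam l - lam m) \<noteq> 0" using neg[OF that(1)] neg[OF that(2)] by simp
      then show ?thesis by force
    qed
    ultimately show ?thesis by (simp add: divide_simps)
  qed
  have "R_fun P Q \<Sigma> z = (matrix_inv (P z) ** Q z) ** cmat \<Sigma> ** transpose (matrix_inv (P (- z)) ** Q (- z))"
    by (simp add: R_fun_def matrix_transpose_mul matrix_mul_assoc)
  also have "\<dots> = (\<Sum>l=1..n. \<Sum>m=1..n. ((1 / (z - lam l)) * (1 / (- z - lam m))) *\<^sub>M ?T l m)"
    unfolding PQ[OF z(1)] PQ[OF z(2)]
    by (subst sum.swap) (simp add: matrix_mult_sum_left matrix_mult_sum_right transpose_sum
        mat_scale_mult_left mat_scale_mult_right transpose_mat_scale mat_scale_mat_scale mat_scale_sum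
        mult.commute)
  also have "\<dots> = (\<Sum>l=1..n. \<Sum>m=1..n. (1 / (z - lam l) * (1 / (- lam l - lam m)) + 1 / (- z - lam m) * (1 / (- lam l - lam m))) *\<^sub>M ?T l m)"
    by (intro sum.cong refl arg_cong2[of _ _ _ _ mat_scale] frac)
  also have "\<dots> = (\<Sum>l=1..n. \<Sum>m=1..n. (1 / (z - lam l) * (1 / (- lam l - lam m))) *\<^sub>M ?T l m) +
      (\<Sum>m=1..n. \<Sum>l=1..n. (1 / (- z - lam m) * (1 / (- lam l - lam m))) *\<^sub>M ?T l m)"
    by (subst (3) sum.swap) (simp add: mat_scale_def vec_eq_iff sum.distrib distrib_right)
  also have "\<dots> = (\<Sum>l=1..n. (1 / (z - lam l)) *\<^sub>M spectral_residue lam n \<rho> \<Sigma> l + (1 / (- z - lam l)) *\<^sub>M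
      (\<Sum>k=1..n. (1 / (- lam k - lam l)) *\<^sub>M ?T k l))"
    by (simp only: mat_scale_def vec_eq_iff spectral_residue_def sum.distrib sum_component vec_lambda_beta plus_vec_def sum_distrib_left mult.assoc simp_thms)
  finally show "R_fun P Q \<Sigma> z = (\<Sum>l=1..n. (1 / (z - lam l)) *\<^sub>M spectral_residue lam n \<rho> \<Sigma> l + (1 / (- z - lam l)) *\<^sub>M
      (\<Sum>k=1..n. (1 / (- lam k - lam l)) *\<^sub>M ?T k l))" .
qed

text \<open>All other terms stay bounded near \<open>lam k\<close> and are killed by the factor
  \<open>z - lam k\<close>: the remaining \<open>lam l\<close> are different by injectivity, and the
  reflected poles lie in the right half-plane.\<close>

lemma simple_pole_coefficient:
  fixes lam a b :: "nat \<Rightarrow> complex"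
  assumes inj: "inj_on lam {1..n}" and neg: "\<And>l. l \<in> {1..n} \<Longrightarrow> Re (lam l) < 0"
    and k: "k \<in> {1..n}"
  shows "((\<lambda>z. (z - lam k) * (\<Sum>l=1..n. a l / (z - lam l) + b l / (- z - lam l))) \<longlongrightarrow> a k) (at (lam k))"
proof -
  have "((\<lambda>z. \<Sum>l=1..n. (z - lam k) * (a l / (z - lam l) + b l / (- z - lam l))) \<longlongrightarrow>
      (\<Sum>l=1..n. if l = k then a k else 0)) (at (lam k))"
  proof (rule tendsto_sum)
    fix l assume l: "l \<in> {1..n}"
    have "Re (- lam k - lam l) \<noteq> 0" using neg[OF l] neg[OF k] by simp
    then have nz: "- lam k - lam l \<noteq> 0" by force
    have b: "((\<lambda>z. (z - lam k) * (b l / (- z - lam l))) \<longlongrightarrow> (lam k - lam k) * (b l / (- lam k - lam l))) (at (lam k))"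
      by (intro tendsto_intros nz)
    show "((\<lambda>z. (z - lam k) * (a l / (z - lam l) + b l / (- z - lam l))) \<longlongrightarrow> (if l = k then a k else 0)) (at (lam k))"
    proof (cases "l = k")
      case True
      have "((\<lambda>z. a k + (z - lam k) * (b l / (- z - lam l))) \<longlongrightarrow> a k + (lam k - lam k) * (b l / (- lam k - lam l))) (at (lam k))"
        by (intro tendsto_add tendsto_const b)
      then have "((\<lambda>z. a k + (z - lam k) * (b l / (- z - lam l))) \<longlongrightarrow> a k) (at (lam k))" by simp
      moreover have "\<forall>\<^sub>F z in at (lam k). a k + (z - lam k) * (b l / (- z - lam l)) =
          (z - lam k) * (a l / (z - lam l) + b l / (- z - lam l))"
        using True by (auto simp: eventually_at_filter distrib_left)
      ultimately show ?thesis using True by (simp add: filterlim_cong)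
    next
      case False
      then have "lam k - lam l \<noteq> 0" using inj_onD[OF inj _ l k] by auto
      then have "((\<lambda>z. (z - lam k) * (a l / (z - lam l))) \<longlongrightarrow> (lam k - lam k) * (a l / (lam k - lam l))) (at (lam k))"
        by (intro tendsto_intros)
      from tendsto_add[OF this b] show ?thesis using False by (simp add: distrib_left)
    qed
  qed
  then show ?thesis using k by (simp add: sum_distrib_left)
qed

text \<open>Each entry of \<open>\<alpha> k\<close> is the limit of \<open>(z - lam k)\<close> times
  the entry of \<open>R\<close> at \<open>lam k\<close>, hence depends on \<open>R\<close> alone.
  This reduces the claim about all decompositions to the one that has been computed.\<close>

lemma partial_fractions_unique:
  assumes pf: "partial_fractions P Q \<Sigma> n lam \<alpha> \<beta>" "partial_fractions P Q \<Sigma> n lam \<alpha>' \<beta>'"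
    and lam: "bij_betw lam {1..n} {z. det (P z) = 0}"
    and neg: "\<And>z. det (P z) = 0 \<Longrightarrow> Re z < 0"
    and k: "k \<in> {1..n}"
  shows "\<alpha> k = \<alpha>' k"
proof -
  have inj: "inj_on lam {1..n}" and img: "lam ` {1..n} = {z. det (P z) = 0}"
    using lam by (auto simp: bij_betw_def)
  have n: "Re (lam l) < 0" if "l \<in> {1..n}" for l
    using img that neg by blast
  \<comment> \<open>The decomposition is only known away from the zeros of both determinants. Close
    to \<open>lam k\<close> the first is nonzero because its zeros are finite in number, the second
    because \<open>z\<close> stays in the left half-plane, so that \<open>- z\<close> cannot be a
    zero.\<close>
  have ev: "\<forall>\<^sub>F z in at (lam k). det (P z) \<noteq> 0 \<and> det (P (- z)) \<noteq> 0"
  proof -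
    have "\<forall>\<^sub>F z in at (lam k). z \<in> - (lam ` {1..n} - {lam k}) - {lam k}"
      by (intro eventually_at_in_open open_Compl finite_imp_closed) auto
    moreover have "\<forall>\<^sub>F z in at (lam k). z \<in> {z. Re z < 0} - {lam k}"
      using n[OF k] by (intro eventually_at_in_open open_halfspace_Re_lt) auto
    ultimately show ?thesis
    proof eventually_elim
      case (elim z)
      then have "z \<notin> {z. det (P z) = 0}" unfolding img[symmetric] by auto
      moreover have "det (P (- z)) \<noteq> 0" using neg[of "- z"] elim by auto
      ultimately show ?case by simp
    qed
  qed
  show ?thesis
    unfolding vec_eq_iff
  proof (intro allI)
    fix i j
    have lim: "((\<lambda>z. (z - lam k) * R_fun P Q \<Sigma> z $ i $ j) \<longlongrightarrow> a k $ i $ j) (at (lam k))"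
      if "partial_fractions P Q \<Sigma> n lam a b" for a b
    proof (rule Lim_transform_eventually)
      show "((\<lambda>z. (z - lam k) * (\<Sum>l=1..n. a l $ i $ j / (z - lam l) + b l $ i $ j / (- z - lam l))) \<longlongrightarrow> a k $ i $ j) (at (lam k))"
        by (rule simple_pole_coefficient[OF inj n k])
      show "\<forall>\<^sub>F z in at (lam k). (z - lam k) * (\<Sum>l=1..n. a l $ i $ j / (z - lam l) + b l $ i $ j / (- z - lam l)) =
          (z - lam k) * R_fun P Q \<Sigma> z $ i $ j"
        using ev by eventually_elim (use that in \<open>simp add: partial_fractions_def mat_scale_def\<close>)
    qed
    show "\<alpha> k $ i $ j = \<alpha>' k $ i $ j"
      by (rule tendsto_unique[OF _ lim[OF pf(1)] lim[OF pf(2)]]) simp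
  qed
qed


section \<open>Two-sided geometric series\<close>

lemma has_sum_vec:
  fixes f :: "'i \<Rightarrow> 'a::topological_comm_monoid_add^'n"
  assumes "\<And>i. ((\<lambda>x. f x $ i) has_sum s $ i) A"
  shows "(f has_sum s) A"
  unfolding has_sum_def
proof (rule vec_tendstoI)
  fix i show "((\<lambda>F. sum f F $ i) \<longlongrightarrow> s $ i) (finite_subsets_at_top A)"
    using assms[of i] unfolding has_sum_def sum_component .
qed

lemma has_sum_finite_sum:
  fixes f :: "'i \<Rightarrow> 'b \<Rightarrow> 'a::topological_comm_monoid_add"
  assumes "\<And>i. i \<in> I \<Longrightarrow> (f i has_sum s i) A"
  shows "((\<lambda>x. \<Sum>i\<in>I. f i x) has_sum (\<Sum>i\<in>I. s i)) A"
  using assms by (induction I rule: infinite_finite_induct) (auto intro: has_sum_add)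

lemma has_sum_geometric:
  fixes x :: complex
  assumes "norm x < 1"
  shows "((\<lambda>n. x ^ n) has_sum 1 / (1 - x)) UNIV"
proof -
  have "(\<lambda>n. norm (x ^ n)) summable_on UNIV"
    using assms by (subst summable_on_UNIV_nonneg_real_iff) (auto simp: norm_power intro!: summable_geometric)
  then show ?thesis
    using norm_summable_imp_has_sum[OF _ geometric_sums[OF assms]] assms
    by (simp add: norm_power summable_geometric)
qed

lemma has_sum_two_sided_geometric:
  fixes a b x y :: complex
  assumes x: "norm x < 1" and y: "norm y < 1"
  shows "((\<lambda>k::int. if k \<ge> 0 then a * x ^ nat k else b * y ^ nat (- k)) has_sum
    (a / (1 - x) + b * y / (1 - y))) UNIV"
proof -
  let ?f = "\<lambda>k::int. if k \<ge> 0 then a * x ^ nat k else b * y ^ nat (- k)"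
  have 1: "(?f has_sum a * (1 / (1 - x))) (range int)"
    using has_sum_cmult_right[OF has_sum_geometric[OF x], of a]
    by (subst has_sum_reindex) (simp_all add: comp_def)
  \<comment> \<open>The negative integers are \<open>- 1 - n\<close>, with exponent
    \<open>n + 1\<close>: this produces the extra factor \<open>y\<close>, and index 0 is counted
    only in the first half.\<close>
  have 2: "(?f has_sum b * y * (1 / (1 - y))) (range (\<lambda>n. - 1 - int n))"
  proof (subst has_sum_reindex)
    have "?f \<circ> (\<lambda>n. - 1 - int n) = (\<lambda>n. b * y * y ^ n)"
      by (auto simp: fun_eq_iff nat_add_distrib)
    then show "((?f \<circ> (\<lambda>n. - 1 - int n)) has_sum b * y * (1 / (1 - y))) UNIV"
      by (simp only: has_sum_cmult_right[OF has_sum_geometric[OF y]])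
  qed (auto simp: inj_on_def)
  have "range int \<inter> range (\<lambda>n. - 1 - int n) = {}" by auto
  from has_sum_Un_disjoint[OF 1 2 this]
  have "(?f has_sum a * (1 / (1 - x)) + b * y * (1 / (1 - y))) (range int \<union> range (\<lambda>n. - 1 - int n))" .
  moreover have "range int \<union> range (\<lambda>n. - 1 - int n) = UNIV"
  proof -
    have "k \<in> range int \<union> range (\<lambda>n. - 1 - int n)" for k
    proof (cases "k \<ge> 0")
      case True
      then show ?thesis by (intro UnI1 range_eqI[of _ _ "nat k"]) simp
    next
      case False
      then show ?thesis by (intro UnI2 range_eqI[of _ _ "nat (- 1 - k)"]) simp
    qed
    then show ?thesis by blast
  qed
  ultimately show ?thesis by simp
qed

text \<open>The \<open>l\<close>-th terms of the geometric sum and of the stated sum differ by \<open>a l - b l\<close>; these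
  differences cancel because the autocovariance at \<open>0\<close> is symmetric.\<close>

lemma sampled_geometric_series:
  fixes a b lam :: "nat \<Rightarrow> complex" and \<Delta> \<omega> :: real
  assumes neg: "\<And>l. l \<in> {1..n} \<Longrightarrow> Re (lam l) < 0" and \<Delta>: "0 < \<Delta>"
    and sym: "(\<Sum>l=1..n. a l) = (\<Sum>l=1..n. b l)"
  shows "((\<lambda>k::int. exp (- \<i> * of_int k * of_real \<omega>) *
      (if k \<ge> 0 then \<Sum>l=1..n. a l * exp (of_real (of_int k * \<Delta>) * lam l)
       else \<Sum>l=1..n. b l * exp (of_real (- of_int k * \<Delta>) * lam l))) has_sum
      (1 / 2) * (\<Sum>l=1..n. (1 / (cosh (of_real \<Delta> * lam l) - of_real (cos \<omega>))) *
        (exp (- \<i> * of_real \<omega>) * (a l - b l) - exp (of_real \<Delta> * lam l) * a l + exp (- of_real \<Delta> * lam l) * b l))) UNIV"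
    (is "(?F has_sum ?S) UNIV")
proof -
  define w where "w = exp (- \<i> * complex_of_real \<omega>)"
  define v where "v = exp (\<i> * complex_of_real \<omega>)"
  define e where "e = (\<lambda>l. exp (complex_of_real \<Delta> * lam l))"
  have wv: "w * v = 1" by (simp add: w_def v_def flip: exp_add)
  have nw: "norm w = 1" "norm v = 1" by (simp_all add: w_def v_def)
  have ne: "norm (e l) < 1" if "l \<in> {1..n}" for l
    using neg[OF that] \<Delta> by (simp add: e_def mult_pos_neg)
  have small: "norm (w * e l) < 1" "norm (v * e l) < 1" if "l \<in> {1..n}" for l
    using ne[OF that] by (simp_all add: norm_mult nw)
  have wp: "exp (- \<i> * of_int k * of_real \<omega>) = w ^ nat k" if "k \<ge> 0" for k
    using that by (simp add: w_def exp_of_nat_mult[symmetric] mult_ac)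
  have vp: "exp (- \<i> * of_int k * of_real \<omega>) = v ^ nat (- k)" if "k < 0" for k
    using that by (simp add: v_def exp_of_nat_mult[symmetric] mult_ac)
  have ep: "exp (of_real (of_int k * \<Delta>) * lam l) = e l ^ nat k" if "k \<ge> 0" for k l
    using that by (simp add: e_def exp_of_nat_mult[symmetric] mult_ac)
  have ep': "exp (of_real (- of_int k * \<Delta>) * lam l) = e l ^ nat (- k)" if "k < 0" for k l
    using ep[of "- k" l] that by simp
  have "((\<lambda>k. \<Sum>l=1..n. if k \<ge> 0 then a l * (w * e l) ^ nat k else b l * (v * e l) ^ nat (- k)) has_sum
      (\<Sum>l=1..n. a l / (1 - w * e l) + b l * (v * e l) / (1 - v * e l))) UNIV"
    by (intro has_sum_finite_sum has_sum_two_sided_geometric small)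
  also have "(\<lambda>k. \<Sum>l=1..n. if k \<ge> 0 then a l * (w * e l) ^ nat k else b l * (v * e l) ^ nat (- k)) = ?F"
  proof
    fix k :: int
    show "(\<Sum>l=1..n. if k \<ge> 0 then a l * (w * e l) ^ nat k else b l * (v * e l) ^ nat (- k)) = ?F k"
    proof (cases "k \<ge> 0")
      case True
      then show ?thesis
        by (simp only: if_True wp[OF True] ep[OF True] sum_distrib_left power_mult_distrib mult.left_commute)
    next
      case False
      then have "k < 0" by simp
      then show ?thesis
        by (simp only: False if_False vp[OF \<open>k < 0\<close>] ep'[OF \<open>k < 0\<close>] sum_distrib_left power_mult_distrib mult.left_commute)
    qed
  qed
  also have "(\<Sum>l=1..n. a l / (1 - w * e l) + b l * (v * e l) / (1 - v * e l)) = ?S"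
  proof -
    have "a l / (1 - w * e l) + b l * (v * e l) / (1 - v * e l) =
        (1 / 2) * ((1 / (cosh (of_real \<Delta> * lam l) - of_real (cos \<omega>))) *
          (w * (a l - b l) - e l * a l + exp (- of_real \<Delta> * lam l) * b l)) + (a l - b l)"
      if l: "l \<in> {1..n}" for l
    proof -
      define E where "E = e l"
      have E0: "E \<noteq> 0" by (simp add: E_def e_def)
      have inv: "exp (- of_real \<Delta> * lam l) = 1 / E" by (simp add: E_def e_def exp_minus divide_inverse)
      have cosh: "cosh (of_real \<Delta> * lam l) = (E + 1 / E) / 2"
        using inv by (simp add: E_def e_def cosh_def scaleR_conv_of_real)
      have cos: "complex_of_real (cos \<omega>) = (w + v) / 2"
        by (simp add: cos_of_real[symmetric] cos_exp_eq w_def v_def add.commute)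
      have n1: "1 - w * E \<noteq> 0" "1 - v * E \<noteq> 0"
        using small[OF l] by (auto simp: E_def)
      have v: "v = 1 / w" "w \<noteq> 0" using wv by (auto simp: w_def eq_divide_eq mult.commute)
      \<comment> \<open>Since \<open>w * v = 1\<close>, twice \<open>E\<close> times the difference
        is \<open>1 - (w + v) E + E^2\<close>, which is the product of the denominators of the two
        geometric series.\<close>
      have den: "(E + 1 / E) / 2 - (w + v) / 2 = (1 - w * E) * (1 - v * E) / (2 * E)"
        using E0 v by (simp add: field_simps)
      show ?thesis
        unfolding inv cosh cos den e_def[symmetric] E_def[symmetric]
        using n1 E0 v(2) unfolding v(1) by (simp add: divide_simps) algebra
    qed
    then have "(\<Sum>l=1..n. a l / (1 - w * e l) + b l * (v * e l) / (1 - v * e l)) =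
        (\<Sum>l=1..n. (1 / 2) * ((1 / (cosh (of_real \<Delta> * lam l) - of_real (cos \<omega>))) *
          (w * (a l - b l) - e l * a l + exp (- of_real \<Delta> * lam l) * b l)) + (a l - b l))"
      by (rule sum.cong[OF refl])
    also have "\<dots> = ?S"
      unfolding sum.distrib sum_subtractf sum_distrib_left using sym by (simp add: w_def e_def)
    finally show ?thesis .
  qed
  finally show ?thesis .
qed

section \<open>Truncated Fourier inversion\<close>

text \<open>Used with \<open>c\<close> a zero of the determinant, such a zero shifted by an
  imaginary number, and a sum of two zeros; in each case the real part is negative.\<close>

lemma exp_tail_integral:
  fixes c :: complex
  assumes c: "Re c < 0"
  shows "set_integrable lborel {a<..} (\<lambda>s. exp (c * of_real s))"
    and "(LINT s:{a<..}|lborel. exp (c * of_real s)) = - exp (c * of_real a) / c"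
proof -
  have "set_integrable lborel {0<..} (\<lambda>s. exp (c * of_real s))"
    unfolding set_integrable_def
  proof (rule Bochner_Integration.integrable_bound)
    show "integrable lborel (\<lambda>s. indicator {0<..} s *\<^sub>R exp (- (s * (- Re c))))"
      using integrable_I0i_exp_mscale[of "- Re c"] c unfolding set_integrable_def by simp
  qed (auto simp: indicator_def mult.commute)
  then have "integrable lborel (\<lambda>s. indicator {0<..} s *\<^sub>R exp (c * of_real s))"
    unfolding set_integrable_def .
  from lborel_integrable_real_affine[OF this, of 1 "- a"]
  have "integrable lborel (\<lambda>s. exp (c * of_real a) * (indicator {0<..} (s - a) *\<^sub>R exp (c * of_real (s - a))))"
    by (intro integrable_mult_right) simp
  then show int: "set_integrable lborel {a<..} (\<lambda>s. exp (c * of_real s))"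
    unfolding set_integrable_def
    by (rule back_subst) (auto simp: fun_eq_iff indicator_def algebra_simps simp flip: exp_add)
  have c0: "c \<noteq> 0" using c by auto
  have "(LBINT s=a..\<infinity>. exp (c * of_real s)) = 0 - exp (c * of_real a) / c"
  proof (rule interval_integral_FTC_integrable[where F="\<lambda>s. exp (c * of_real s) / c"])
    show "((\<lambda>s. exp (c * of_real s) / c) has_vector_derivative exp (c * of_real x)) (at x)" for x
      using c0 by (auto intro!: derivative_eq_intros has_vector_derivative_real_field simp: field_simps)
    show "set_integrable lborel (einterval (ereal a) \<infinity>) (\<lambda>s. exp (c * of_real s))"
      using int by simp
    have "((\<lambda>s. exp (c * of_real s) / c) \<longlongrightarrow> exp (c * of_real a) / c) (at_right a)"
      by (intro tendsto_intros) (auto simp: c0)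
    then show "(((\<lambda>s. exp (c * of_real s) / c) \<circ> real_of_ereal) \<longlongrightarrow> exp (c * of_real a) / c) (at_right (ereal a))"
      by (simp add: ereal_tendsto_simps)
    have "((\<lambda>s. exp (Re c * s)) \<longlongrightarrow> 0) at_top"
      using c by (intro filterlim_compose[OF exp_at_bot] filterlim_tendsto_neg_mult_at_bot[OF tendsto_const] filterlim_ident)
    then have "((\<lambda>s. exp (c * of_real s)) \<longlongrightarrow> 0) at_top"
      by (subst tendsto_norm_zero_iff[symmetric]) simp
    then have "((\<lambda>s. exp (c * of_real s) / c) \<longlongrightarrow> 0) at_top"
      using tendsto_divide_zero by blast
    then show "(((\<lambda>s. exp (c * of_real s) / c) \<circ> real_of_ereal) \<longlongrightarrow> 0) (at_left \<infinity>)"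
      by (simp add: ereal_tendsto_simps)
  qed (auto intro!: continuous_intros)
  then show "(LINT s:{a<..}|lborel. exp (c * of_real s)) = - exp (c * of_real a) / c"
    by (simp add: interval_integral_to_infinity_eq)
qed

text \<open>Writing \<open>2 sin(N u) / u\<close> through \<open>sinc\<close> covers
  \<open>u = 0\<close> as well, so that the kernel can be integrated over \<open>u\<close> without
  an exceptional point.\<close>

lemma Dirichlet_kernel_integral:
  fixes N u :: real
  assumes N: "0 \<le> N"
  shows "(LINT x:{-N..N}|lborel. exp (\<i> * of_real (u * x))) = of_real (2 * N * sinc (N * u))"
proof (cases "u = 0")
  case True
  then show ?thesis using N by (simp add: set_lebesgue_integral_def measure_def scaleR_conv_of_real)
next
  case False
  define G where "G = (\<lambda>x::real. exp (\<i> * of_real (u * x)) / (\<i> * of_real u))"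
  have "(LBINT x=-N..N. exp (\<i> * of_real (u * x))) = G N - G (- N)"
    using N False
    by (intro interval_integral_FTC_finite)
       (auto simp: G_def field_simps intro!: derivative_eq_intros has_vector_derivative_real_field continuous_intros)
  also have "\<dots> = of_real (2 * N * sinc (N * u))"
    using False N by (cases "N = 0") (auto simp: G_def divide_simps exp_Euler algebra_simps simp flip: cos_of_real sin_of_real)
  also have "(LBINT x=-N..N. exp (\<i> * of_real (u * x))) = (LINT x:{-N..N}|lborel. exp (\<i> * of_real (u * x)))"
    using N by (simp add: interval_integral_Icc)
  finally show ?thesis .
qed

text \<open>The fraction is the integral of \<open>exp((c - i x) s)\<close> over
  \<open>s > 0\<close>. Cutting off \<open>x\<close> makes the double integral absolutely
  convergent, so Fubini moves the integral over \<open>x\<close> inside, where it is a Dirichlet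
  kernel.\<close>

lemma truncated_fourier_eq_sinc:
  fixes c :: complex
  assumes c: "Re c < 0" and N: "0 \<le> N"
  shows "(LINT x:{-N..N}|lborel. exp (\<i> * of_real (t * x)) / (\<i> * of_real x - c))
       = (LINT s:{0<..}|lborel. exp (c * of_real s) * of_real (2 * N * sinc (N * (t - s))))"
proof -
  define f where "f = (\<lambda>x s::real. indicator {-N..N} x *\<^sub>R indicator {0<..} s *\<^sub>R
    (exp (\<i> * of_real (t * x)) * exp ((c - \<i> * of_real x) * of_real s)))"
  have [measurable]: "case_prod f \<in> borel_measurable (lborel \<Otimes>\<^sub>M lborel)"
    unfolding f_def by measurable
  have norm_f: "norm (f x s) = indicator {-N..N} x * (indicator {0<..} s * exp (Re c * s))" for x s
    by (simp add: f_def norm_mult indicator_def)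
  have inner: "integrable lborel (f x)" "(\<integral>s. f x s \<partial>lborel) =
      indicator {-N..N} x *\<^sub>R (exp (\<i> * of_real (t * x)) / (\<i> * of_real x - c))" for x
  proof -
    have rc: "Re (c - \<i> * of_real x) < 0" using c by simp
    have eq: "f x = (\<lambda>s. (indicator {-N..N} x *\<^sub>R exp (\<i> * of_real (t * x))) *
        (indicator {0<..} s *\<^sub>R exp ((c - \<i> * of_real x) * of_real s)))"
      by (auto simp: f_def fun_eq_iff indicator_def)
    show "integrable lborel (f x)"
      unfolding eq using exp_tail_integral(1)[OF rc, of 0]
      by (intro integrable_mult_right) (simp add: set_integrable_def)
    have "(\<integral>s. f x s \<partial>lborel) = (indicator {-N..N} x *\<^sub>R exp (\<i> * of_real (t * x))) *
        (LINT s:{0<..}|lborel. exp ((c - \<i> * of_real x) * of_real s))"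
      unfolding eq set_lebesgue_integral_def by (rule integral_mult_right_zero)
    also have "\<dots> = indicator {-N..N} x *\<^sub>R (exp (\<i> * of_real (t * x)) / (\<i> * of_real x - c))"
      by (subst exp_tail_integral(2)[OF rc]) (simp add: minus_divide_right indicator_def)
    finally show "(\<integral>s. f x s \<partial>lborel) =
      indicator {-N..N} x *\<^sub>R (exp (\<i> * of_real (t * x)) / (\<i> * of_real x - c))" .
  qed
  have "integrable (lborel \<Otimes>\<^sub>M lborel) (case_prod f)"
  proof (rule lborel_pair.Fubini_integrable)
    show "integrable lborel (\<lambda>x. \<integral>y. norm (case_prod f (x, y)) \<partial>lborel)"
      unfolding prod.case norm_f
      by (simp add: integrable_real_indicator emeasure_lborel_Icc_eq)
  qed (auto simp: inner)
  then have "(\<integral>s. (\<integral>x. f x s \<partial>lborel) \<partial>lborel) = (\<integral>x. (\<integral>s. f x s \<partial>lborel) \<partial>lborel)"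
    by (rule lborel_pair.Fubini_integral)
  also have "\<dots> = (LINT x:{-N..N}|lborel. exp (\<i> * of_real (t * x)) / (\<i> * of_real x - c))"
    by (simp add: inner set_lebesgue_integral_def)
  also have "(\<lambda>s. \<integral>x. f x s \<partial>lborel) =
      (\<lambda>s. indicator {0<..} s *\<^sub>R (exp (c * of_real s) * of_real (2 * N * sinc (N * (t - s)))))"
  proof
    fix s
    have "f x s = (indicator {0<..} s *\<^sub>R exp (c * of_real s)) *
        (indicator {-N..N} x *\<^sub>R exp (\<i> * of_real ((t - s) * x)))" for x
      by (auto simp: f_def indicator_def algebra_simps simp flip: exp_add)
    then have "(\<integral>x. f x s \<partial>lborel) = (indicator {0<..} s *\<^sub>R exp (c * of_real s)) *
        (LINT x:{-N..N}|lborel. exp (\<i> * of_real ((t - s) * x)))"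
      unfolding set_lebesgue_integral_def by (simp only: integral_mult_right_zero)
    then show "(\<integral>x. f x s \<partial>lborel) =
        indicator {0<..} s *\<^sub>R (exp (c * of_real s) * of_real (2 * N * sinc (N * (t - s))))"
      unfolding Dirichlet_kernel_integral[OF N] by simp
  qed
  finally show ?thesis by (simp add: set_lebesgue_integral_def)
qed

lemma Si_uminus: "Si (- x) = - Si x"
  using Si_neg[of x] Si_neg[of "- x"] by (cases "0 \<le> x") auto

text \<open>Integration by parts against the primitive \<open>Si\<close> of \<open>sinc\<close>. The
  kernel \<open>N * sinc (N * (t - s))\<close> is not dominated uniformly in \<open>N\<close> near
  \<open>s = t\<close>, whereas \<open>Si\<close> is bounded, so this form admits dominated
  convergence as \<open>N\<close> grows.\<close>

lemma truncated_fourier_eq_Si: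
  fixes c :: complex
  assumes c: "Re c < 0" and N: "0 \<le> N"
  shows "(LINT x:{-N..N}|lborel. exp (\<i> * of_real (t * x)) / (\<i> * of_real x - c))
       = 2 * of_real (Si (N * t)) + 2 * (LINT s:{0<..}|lborel. c * exp (c * of_real s) * of_real (Si (N * (t - s))))"
proof -
  obtain K where K: "\<And>T. \<bar>Si T\<bar> \<le> K" using bounded_Si by blast
  let ?G = "\<lambda>s. exp (c * of_real s) * complex_of_real (Si (N * (t - s)))"
  let ?f = "\<lambda>s. exp (c * of_real s) * complex_of_real (N * sinc (N * (t - s)))"
  let ?h = "\<lambda>s. c * exp (c * of_real s) * complex_of_real (Si (N * (t - s)))"
  have K0: "0 \<le> K" using K[of 0] by linarith
  have e: "integrable lborel (\<lambda>s. indicator {0<..} s *\<^sub>R exp (c * of_real s))"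
    using exp_tail_integral(1)[OF c, of 0] unfolding set_integrable_def .
  have indicator_le: "norm (indicator {0<..} (s::real) *\<^sub>R x) \<le> norm (y * (indicator {0<..} s *\<^sub>R z))"
    if "norm x \<le> norm (y * z)" for s and x y z :: complex
    using that by (simp add: indicator_def)
  have int1: "set_integrable lborel {0<..} ?h"
    unfolding set_integrable_def
  proof (rule Bochner_Integration.integrable_bound)
    show "integrable lborel (\<lambda>s. (c * of_real K) * (indicator {0<..} s *\<^sub>R exp (c * of_real s)))"
      using e by (rule integrable_mult_right)
    show "AE s in lborel. norm (indicator {0<..} s *\<^sub>R ?h s) \<le>
       norm ((c * of_real K) * (indicator {0<..} s *\<^sub>R exp (c * of_real s)))"
    proof (rule AE_I2, rule indicator_le)
      fix s
      have "norm (c * exp (c * of_real s)) * \<bar>Si (N * (t - s))\<bar> \<le> norm (c * exp (c * of_real s)) * K"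
        by (intro mult_left_mono K) auto
      then show "norm (?h s) \<le> norm ((c * of_real K) * exp (c * of_real s))"
        using K0 by (simp add: norm_mult mult_ac)
    qed
  qed measurable
  have sinc_le: "\<bar>sinc x\<bar> \<le> 1" for x
    using abs_sin_le_one[of x] abs_sin_x_le_abs_x[of x] by (auto simp: divide_simps)
  have int2: "set_integrable lborel {0<..} ?f"
    unfolding set_integrable_def
  proof (rule Bochner_Integration.integrable_bound)
    show "integrable lborel (\<lambda>s. of_real N * (indicator {0<..} s *\<^sub>R exp (c * of_real s)))"
      using e by (rule integrable_mult_right)
    show "AE s in lborel. norm (indicator {0<..} s *\<^sub>R ?f s) \<le>
       norm (of_real N * (indicator {0<..} s *\<^sub>R exp (c * of_real s)))"
    proof (rule AE_I2)
      fix s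
      have "norm (?f s) = N * norm (exp (c * of_real s)) * \<bar>sinc (N * (t - s))\<bar>"
        using N by (simp add: norm_mult abs_mult del: norm_exp_eq_Re)
      also have "\<dots> \<le> N * norm (exp (c * of_real s)) * 1"
        using N by (intro mult_left_mono sinc_le) auto
      also have "\<dots> = norm (of_real N * exp (c * of_real s))"
        using N by (simp add: norm_mult del: norm_exp_eq_Re)
      finally have le: "norm (?f s) \<le> norm (of_real N * exp (c * of_real s))" .
      from indicator_le[OF le] show "norm (indicator {0<..} s *\<^sub>R ?f s) \<le>
         norm (of_real N * (indicator {0<..} s *\<^sub>R exp (c * of_real s)))" .
    qed
  qed measurable
  have isc: "isCont (\<lambda>x. sinc (N * (t - x))) x" for x
    by (rule continuous_within_compose3[OF isCont_sinc]) (auto intro!: continuous_intros)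
  have iSi: "isCont (\<lambda>x. Si (N * (t - x))) x" for x
    by (rule continuous_within_compose3[OF isCont_Si]) (auto intro!: continuous_intros)
  \<comment> \<open>The integrand is the derivative of \<open>?G\<close>, which equals
    \<open>Si (N * t)\<close> at 0 and tends to 0 at infinity because \<open>Si\<close> is bounded
    and the exponential decays.\<close>
  have "(LBINT s=0..\<infinity>. ?h s - ?f s) = 0 - of_real (Si (N * t))"
  proof (rule interval_integral_FTC_integrable[where F="?G"])
    fix x
    have d: "((\<lambda>s. Si (N * (t - s))) has_real_derivative (sinc (N * (t - x)) * (- N))) (at x)"
      by (rule DERIV_chain2[OF DERIV_Si]) (auto intro!: derivative_eq_intros)
    have "((\<lambda>s. exp (c * of_real s)) has_vector_derivative (c * exp (c * of_real x))) (at x)"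
      by (auto intro!: derivative_eq_intros has_vector_derivative_real_field)
    from has_vector_derivative_mult[OF this has_vector_derivative_of_real[OF d]]
    show "(?G has_vector_derivative ?h x - ?f x) (at x)"
      by (rule has_vector_derivative_eq_rhs) (simp add: algebra_simps)
    show "isCont (\<lambda>s. ?h s - ?f s) x"
      by (intro isCont_diff isCont_mult continuous_of_real isc iSi continuous_exp continuous_const continuous_ident)
  next
    show "set_integrable lborel (einterval 0 \<infinity>) (\<lambda>s. ?h s - ?f s)"
      using set_integral_diff(1)[OF int1 int2] by (simp add: zero_ereal_def)
    have "isCont ?G 0"
      by (intro isCont_mult continuous_exp continuous_of_real iSi continuous_const continuous_ident)
    then have "(?G \<longlongrightarrow> ?G 0) (at_right 0)"
      unfolding isCont_def by (rule tendsto_mono[rotated]) (simp add: at_le)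
    then show "((?G \<circ> real_of_ereal) \<longlongrightarrow> of_real (Si (N * t))) (at_right 0)"
      by (simp add: zero_ereal_def ereal_tendsto_simps)
    have "((\<lambda>s. K * exp (Re c * s)) \<longlongrightarrow> 0) at_top"
      using c by (intro tendsto_mult_right_zero filterlim_compose[OF exp_at_bot] filterlim_tendsto_neg_mult_at_bot[OF tendsto_const] filterlim_ident)
    then have "(?G \<longlongrightarrow> 0) at_top"
      by (rule Lim_null_comparison[rotated])
        (auto simp: norm_mult mult.commute intro!: always_eventually mult_right_mono K)
    then show "((?G \<circ> real_of_ereal) \<longlongrightarrow> 0) (at_left \<infinity>)"
      by (simp add: ereal_tendsto_simps)
  qed auto
  then have "(LINT s:{0<..}|lborel. ?h s) - (LINT s:{0<..}|lborel. ?f s) = - of_real (Si (N * t))"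
    using set_integral_diff(2)[OF int1 int2] by (simp add: interval_lebesgue_integral_0_infty)
  moreover have "(LINT s:{0<..}|lborel. exp (c * of_real s) * of_real (2 * N * sinc (N * (t - s))))
      = 2 * (LINT s:{0<..}|lborel. ?f s)"
    by (subst set_integral_mult_right[symmetric]) (simp add: mult_ac)
  moreover have "L = 2 * S + 2 * H" if "H - I = - S" "L = 2 * I" for L S H I :: complex
    using that by algebra
  ultimately show ?thesis
    unfolding truncated_fourier_eq_sinc[OF c N] by blast
qed

text \<open>\<open>Si (n * u)\<close> tends to \<open>sgn u * pi / 2\<close>, and boundedness of
  \<open>Si\<close> allows the limit under the integral. At \<open>t = 0\<close> the limit would be
  half of the jump, neither of the two values given.\<close>

lemma truncated_fourier_limit:
  fixes c :: complex
  assumes c: "Re c < 0" and t: "t \<noteq> 0"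
  shows "(\<lambda>n. LINT x:{-real n..real n}|lborel. exp (\<i> * of_real (t * x)) / (\<i> * of_real x - c))
    \<longlonglongrightarrow> (if t > 0 then 2 * pi * exp (c * of_real t) else 0)"
proof -
  have c0: "c \<noteq> 0" using c by auto
  obtain K where K: "\<And>T. \<bar>Si T\<bar> \<le> K" using bounded_Si by blast
  have K0: "0 \<le> K" using K[of 0] by linarith
  have lim: "(\<lambda>n. Si (real n * u)) \<longlonglongrightarrow> sgn u * (pi / 2)" if "u \<noteq> 0" for u
  proof -
    have pos: "(\<lambda>n. Si (real n * v)) \<longlonglongrightarrow> pi / 2" if "v > 0" for v
      using that
      by (intro filterlim_compose[OF Si_at_top] filterlim_at_top_mult_tendsto_pos[OF tendsto_const] filterlim_real_sequentially)
    show ?thesis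
      using pos[of u] tendsto_minus[OF pos[of "- u"]] that by (cases "u > 0") (auto simp: Si_uminus)
  qed
  let ?J = "\<lambda>n. LINT s:{0<..}|lborel. c * exp (c * of_real s) * of_real (Si (real n * (t - s)))"
  let ?g = "\<lambda>s. c * exp (c * of_real s) * of_real (sgn (t - s) * (pi / 2))"
  have e: "integrable lborel (\<lambda>s. indicator {a<..} s *\<^sub>R exp (c * of_real s))" for a
    using exp_tail_integral(1)[OF c, of a] unfolding set_integrable_def .
  have "?J \<longlonglongrightarrow> (LINT s:{0<..}|lborel. ?g s)"
    unfolding set_lebesgue_integral_def
  proof (rule integral_dominated_convergence)
    show "integrable lborel (\<lambda>s. norm ((c * of_real K) * (indicator {0<..} s *\<^sub>R exp (c * of_real s))))"
      using e by (intro integrable_norm integrable_mult_right)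
    show "AE s in lborel. norm (indicator {0<..} s *\<^sub>R (c * exp (c * of_real s) * of_real (Si (real n * (t - s)))))
        \<le> norm ((c * of_real K) * (indicator {0<..} s *\<^sub>R exp (c * of_real s)))" for n
    proof (rule AE_I2)
      fix s
      have "norm (c * exp (c * of_real s)) * \<bar>Si (real n * (t - s))\<bar> \<le> norm (c * exp (c * of_real s)) * K"
        by (intro mult_left_mono K) auto
      then show "norm (indicator {0<..} s *\<^sub>R (c * exp (c * of_real s) * of_real (Si (real n * (t - s)))))
        \<le> norm ((c * of_real K) * (indicator {0<..} s *\<^sub>R exp (c * of_real s)))"
        using K0 by (simp add: norm_mult indicator_def mult_ac)
    qed
    show "AE s in lborel. (\<lambda>n. indicator {0<..} s *\<^sub>R (c * exp (c * of_real s) * of_real (Si (real n * (t - s)))))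
        \<longlonglongrightarrow> indicator {0<..} s *\<^sub>R ?g s"
      using AE_lborel_singleton[of t]
      by eventually_elim (intro tendsto_intros lim, auto)
  qed measurable
  moreover have "(LINT s:{0<..}|lborel. ?g s) =
      (if t > 0 then pi * exp (c * of_real t) - pi / 2 else pi / 2)"
  proof -
    \<comment> \<open>For almost all \<open>s > 0\<close> the sign of \<open>t - s\<close> is 1
      minus twice the indicator of \<open>s > max t 0\<close>. Thus both signs of \<open>t\<close>
      reduce to two exponential tails.\<close>
    let ?a = "max t 0"
    have "(LINT s:{0<..}|lborel. ?g s) = (\<integral>s. (c * (pi / 2)) * (indicator {0<..} s *\<^sub>R exp (c * of_real s)) -
        (c * pi) * (indicator {?a<..} s *\<^sub>R exp (c * of_real s)) \<partial>lborel)"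
      unfolding set_lebesgue_integral_def
    proof (rule integral_cong_AE)
      show "AE s in lborel. indicator {0<..} s *\<^sub>R ?g s = (c * (pi / 2)) * (indicator {0<..} s *\<^sub>R exp (c * of_real s)) -
        (c * pi) * (indicator {?a<..} s *\<^sub>R exp (c * of_real s))"
        using AE_lborel_singleton[of t]
        by eventually_elim (auto simp: indicator_def sgn_real_def max_def split: if_splits)
    qed measurable
    also have "\<dots> = (c * (pi / 2)) * (LINT s:{0<..}|lborel. exp (c * of_real s)) -
        (c * pi) * (LINT s:{?a<..}|lborel. exp (c * of_real s))"
      unfolding set_lebesgue_integral_def
      by (subst Bochner_Integration.integral_diff)
        (simp_all only: integral_mult_right_zero integrable_mult_right[OF e])
    also have "\<dots> = (if t > 0 then pi * exp (c * of_real t) - pi / 2 else pi / 2)"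
      using c0 by (simp add: exp_tail_integral(2)[OF c] max_def field_simps)
    finally show ?thesis .
  qed
  ultimately have J: "?J \<longlonglongrightarrow> (if t > 0 then pi * exp (c * of_real t) - pi / 2 else pi / 2)"
    by simp
  have "(\<lambda>n. 2 * of_real (Si (real n * t)) + 2 * ?J n) \<longlonglongrightarrow> 2 * of_real (sgn t * (pi / 2)) +
      2 * (if t > 0 then pi * exp (c * of_real t) - pi / 2 else pi / 2)"
    by (intro tendsto_intros lim t J)
  then show ?thesis
    using t by (subst truncated_fourier_eq_Si[OF c]) (auto split: if_splits simp: mult.assoc)
qed

section \<open>Square integrable functions\<close>

text \<open>The measure is a parameter because the isometry compares two such spaces: random
  variables under \<open>M\<close> and kernels under Lebesgue measure.\<close>

definition square_integrable :: "'a measure \<Rightarrow> ('a \<Rightarrow> real) \<Rightarrow> bool"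
  where "square_integrable M f \<longleftrightarrow> f \<in> borel_measurable M \<and> integrable M (\<lambda>x. (f x)\<^sup>2)"

lemma square_integrable_mult:
  assumes "square_integrable M f" "square_integrable M g"
  shows "integrable M (\<lambda>x. f x * g x)"
proof (rule Bochner_Integration.integrable_bound)
  show "integrable M (\<lambda>x. (f x)\<^sup>2 + (g x)\<^sup>2)"
    using assms by (simp add: square_integrable_def)
  show "(\<lambda>x. f x * g x) \<in> borel_measurable M"
    using assms by (auto simp: square_integrable_def)
  have "\<bar>a * b\<bar> \<le> a\<^sup>2 + b\<^sup>2" for a b :: real
  proof -
    have "2 * \<bar>a * b\<bar> \<le> a\<^sup>2 + b\<^sup>2"
      using sum_squares_bound[of "\<bar>a\<bar>" "\<bar>b\<bar>"] by (simp add: abs_mult)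
    then show ?thesis by linarith
  qed
  then show "AE x in M. norm (f x * g x) \<le> norm ((f x)\<^sup>2 + (g x)\<^sup>2)" by simp
qed

lemma square_integrable_cmult: "square_integrable M f \<Longrightarrow> square_integrable M (\<lambda>x. c * f x)"
  by (auto simp: square_integrable_def power_mult_distrib)

lemma square_integrable_add:
  assumes "square_integrable M f" "square_integrable M g"
  shows "square_integrable M (\<lambda>x. f x + g x)"
proof -
  have "integrable M (\<lambda>x. (f x)\<^sup>2 + (g x)\<^sup>2 + 2 * (f x * g x))"
    using assms square_integrable_mult[OF assms] by (auto simp: square_integrable_def)
  then have "integrable M (\<lambda>x. (f x + g x)\<^sup>2)"
    by (simp add: power2_sum algebra_simps)
  then show ?thesis using assms by (auto simp: square_integrable_def)
qed

lemma square_integrable_minus: "square_integrable M f \<Longrightarrow> square_integrable M (\<lambda>x. - f x)"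
  using square_integrable_cmult[of M f "- 1"] by simp

lemma square_integrable_diff:
  assumes "square_integrable M f" "square_integrable M g"
  shows "square_integrable M (\<lambda>x. f x - g x)"
  using square_integrable_add[OF assms(1) square_integrable_minus[OF assms(2)]] by simp

lemma square_integrable_zero: "square_integrable M (\<lambda>x. 0)"
  by (simp add: square_integrable_def)

lemma square_integrable_sum:
  "(\<And>i. i \<in> I \<Longrightarrow> square_integrable M (f i)) \<Longrightarrow> square_integrable M (\<lambda>x. \<Sum>i\<in>I. f i x)"
  by (induction I rule: infinite_finite_induct) (auto intro: square_integrable_add square_integrable_zero)

lemma square_integrable_cong_AE:
  assumes "AE x in M. f x = g x" "g \<in> borel_measurable M" "square_integrable M f"
  shows "square_integrable M g"
proof -
  have "integrable M (\<lambda>x. (f x)\<^sup>2) \<longleftrightarrow> integrable M (\<lambda>x. (g x)\<^sup>2)"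
    using assms by (intro integrable_cong_AE) (auto simp: square_integrable_def)
  then show ?thesis using assms by (simp add: square_integrable_def)
qed

lemma square_integrable_iff_nn_integral:
  "square_integrable M f \<longleftrightarrow> f \<in> borel_measurable M \<and> (\<integral>\<^sup>+x. ennreal ((f x)\<^sup>2) \<partial>M) < \<infinity>"
  by (auto simp: square_integrable_def integrable_iff_bounded)

lemma (in finite_measure) square_integrable_imp_integrable':
  "square_integrable M f \<Longrightarrow> integrable M f"
  by (auto simp: square_integrable_def intro: square_integrable_imp_integrable)

lemma Cauchy_Schwarz_integral:
  assumes f: "square_integrable M f" and g: "square_integrable M g"
  shows "\<bar>\<integral>x. f x * g x \<partial>M\<bar> \<le> sqrt (\<integral>x. (f x)\<^sup>2 \<partial>M) * sqrt (\<integral>x. (g x)\<^sup>2 \<partial>M)"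
proof -
  define a b c where "a = (\<integral>x. (f x)\<^sup>2 \<partial>M)" and "b = (\<integral>x. (g x)\<^sup>2 \<partial>M)" and "c = (\<integral>x. f x * g x \<partial>M)"
  have int: "integrable M (\<lambda>x. (f x)\<^sup>2)" "integrable M (\<lambda>x. (g x)\<^sup>2)" "integrable M (\<lambda>x. f x * g x)"
    using f g square_integrable_mult[OF f g] by (auto simp: square_integrable_def)
  have a0: "0 \<le> a" and b0: "0 \<le> b" by (simp_all add: a_def b_def)
  have "c\<^sup>2 \<le> a * b"
  proof (cases "b = 0")
    case True
    then have "AE x in M. (g x)\<^sup>2 = 0"
      using integral_nonneg_eq_0_iff_AE[OF int(2)] by (simp add: b_def)
    then have "AE x in M. f x * g x = 0" by eventually_elim simp
    then have "c = 0" unfolding c_def by (rule integral_eq_zero_AE)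
    then show ?thesis using True by simp
  next
    case False
    \<comment> \<open>The weights \<open>b\<close> and \<open>c\<close> give the minimizing
      combination without a division: the integral equals \<open>b * (a * b - c^2)\<close>.\<close>
    have "0 \<le> (\<integral>x. (b * f x - c * g x)\<^sup>2 \<partial>M)" by simp
    also have "(\<lambda>x. (b * f x - c * g x)\<^sup>2) = (\<lambda>x. b\<^sup>2 * (f x)\<^sup>2 + c\<^sup>2 * (g x)\<^sup>2 - (2 * b * c) * (f x * g x))"
      by (auto simp: fun_eq_iff power2_eq_square algebra_simps)
    also have "(\<integral>x. b\<^sup>2 * (f x)\<^sup>2 + c\<^sup>2 * (g x)\<^sup>2 - (2 * b * c) * (f x * g x) \<partial>M) = b\<^sup>2 * a + c\<^sup>2 * b - (2 * b * c) * c"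
      using int by (simp add: a_def b_def c_def)
    also have "\<dots> = b * (a * b - c\<^sup>2)" by (simp add: power2_eq_square algebra_simps)
    finally show ?thesis using False b0 by (simp add: zero_le_mult_iff)
  qed
  then have "sqrt (c\<^sup>2) \<le> sqrt (a * b)" by (rule real_sqrt_le_mono)
  then show ?thesis by (simp add: real_sqrt_mult a_def b_def c_def)
qed

text \<open>One index at finite distance already shows that the limit is square integrable. From
  then on the extended nonnegative integrals are ordinary real ones.\<close>

lemma L2_limit_square_integrable:
  assumes X: "\<And>n. square_integrable M (X n)" and Z: "Z \<in> borel_measurable M"
    and lim: "(\<lambda>n. \<integral>\<^sup>+x. ennreal ((X n x - Z x)\<^sup>2) \<partial>M) \<longlonglongrightarrow> 0"
  shows "square_integrable M Z" "(\<lambda>n. \<integral>x. (X n x - Z x)\<^sup>2 \<partial>M) \<longlonglongrightarrow> 0"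
proof -
  have Xm: "X n \<in> borel_measurable M" for n using X by (simp add: square_integrable_def)
  have "\<forall>\<^sub>F n in sequentially. (\<integral>\<^sup>+x. ennreal ((X n x - Z x)\<^sup>2) \<partial>M) < 1"
    using lim by (rule order_tendstoD) simp
  then obtain n where "(\<integral>\<^sup>+x. ennreal ((X n x - Z x)\<^sup>2) \<partial>M) < 1"
    by (auto simp: eventually_sequentially)
  then have "square_integrable M (\<lambda>x. X n x - Z x)"
    unfolding square_integrable_iff_nn_integral using Xm Z
    by (auto intro: less_trans)
  from square_integrable_diff[OF X[of n] this] show *: "square_integrable M Z" by simp
  have "(\<lambda>n. enn2real (\<integral>\<^sup>+x. ennreal ((X n x - Z x)\<^sup>2) \<partial>M)) \<longlonglongrightarrow> 0"
    by (rule tendsto_enn2real) (use lim in simp_all)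
  then show "(\<lambda>n. \<integral>x. (X n x - Z x)\<^sup>2 \<partial>M) \<longlonglongrightarrow> 0"
    using Xm Z by (simp add: integral_eq_nn_integral)
qed

text \<open>Continuity of the inner product: \<open>X Y - Z W\<close> is
  \<open>(X - Z)(Y - W) + Z (Y - W) + (X - Z) W\<close>, and Cauchy-Schwarz bounds each term. It
  carries the isometry from step functions to their limits.\<close>

lemma L2_limit_inner:
  assumes X: "\<And>n. square_integrable M (X n)" and Z: "Z \<in> borel_measurable M"
    and limX: "(\<lambda>n. \<integral>\<^sup>+x. ennreal ((X n x - Z x)\<^sup>2) \<partial>M) \<longlonglongrightarrow> 0"
    and Y: "\<And>n. square_integrable M (Y n)" and W: "W \<in> borel_measurable M"
    and limY: "(\<lambda>n. \<integral>\<^sup>+x. ennreal ((Y n x - W x)\<^sup>2) \<partial>M) \<longlonglongrightarrow> 0"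
  shows "(\<lambda>n. \<integral>x. X n x * Y n x \<partial>M) \<longlonglongrightarrow> (\<integral>x. Z x * W x \<partial>M)"
proof -
  note Z' = L2_limit_square_integrable[OF X Z limX]
  note W' = L2_limit_square_integrable[OF Y W limY]
  let ?a = "\<lambda>n. sqrt (\<integral>x. (X n x - Z x)\<^sup>2 \<partial>M)" and ?b = "\<lambda>n. sqrt (\<integral>x. (Y n x - W x)\<^sup>2 \<partial>M)"
  let ?A = "sqrt (\<integral>x. (Z x)\<^sup>2 \<partial>M)" and ?B = "sqrt (\<integral>x. (W x)\<^sup>2 \<partial>M)"
  have a: "?a \<longlonglongrightarrow> 0" and b: "?b \<longlonglongrightarrow> 0"
    using tendsto_real_sqrt[OF Z'(2)] tendsto_real_sqrt[OF W'(2)] by simp_all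
  have dX: "square_integrable M (\<lambda>x. X n x - Z x)" and dY: "square_integrable M (\<lambda>x. Y n x - W x)" for n
    by (intro square_integrable_diff X Y Z' W')+
  have le: "norm ((\<integral>x. X n x * Y n x \<partial>M) - (\<integral>x. Z x * W x \<partial>M)) \<le> ?a n * ?b n + ?A * ?b n + ?a n * ?B" for n
  proof -
    have "(\<integral>x. X n x * Y n x \<partial>M) - (\<integral>x. Z x * W x \<partial>M) = (\<integral>x. X n x * Y n x - Z x * W x \<partial>M)"
      by (intro Bochner_Integration.integral_diff[symmetric] square_integrable_mult X Y Z' W')
    also have "(\<lambda>x. X n x * Y n x - Z x * W x) = (\<lambda>x. (X n x - Z x) * (Y n x - W x) + Z x * (Y n x - W x) + (X n x - Z x) * W x)"
      by (auto simp: algebra_simps)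
    also have "(\<integral>x. (X n x - Z x) * (Y n x - W x) + Z x * (Y n x - W x) + (X n x - Z x) * W x \<partial>M) =
        (\<integral>x. (X n x - Z x) * (Y n x - W x) \<partial>M) + (\<integral>x. Z x * (Y n x - W x) \<partial>M) + (\<integral>x. (X n x - Z x) * W x \<partial>M)"
      by (simp add: square_integrable_mult dX dY Z' W')
    finally show ?thesis
      using Cauchy_Schwarz_integral[OF dX[of n] dY[of n]] Cauchy_Schwarz_integral[OF Z'(1) dY[of n]]
        Cauchy_Schwarz_integral[OF dX[of n] W'(1)] by simp
  qed
  have "(\<lambda>n. ?a n * ?b n + ?A * ?b n + ?a n * ?B) \<longlonglongrightarrow> 0 * 0 + ?A * 0 + 0 * ?B"
    by (intro tendsto_intros a b)
  then have "(\<lambda>n. ?a n * ?b n + ?A * ?b n + ?a n * ?B) \<longlonglongrightarrow> 0" by simp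
  with always_eventually[OF allI[OF le]]
  have "(\<lambda>n. (\<integral>x. X n x * Y n x \<partial>M) - (\<integral>x. Z x * W x \<partial>M)) \<longlonglongrightarrow> 0"
    by (rule Lim_null_comparison)
  then show ?thesis by (rule LIM_zero_cancel)
qed

text \<open>Cauchy's functional equation on the half-line. The defect \<open>g\<close> from
  linearity is additive and vanishes at the natural numbers, so a bound on \<open>[0, 1]\<close>
  holds everywhere; since \<open>g (n * t) = n * g t\<close>, a bounded \<open>g\<close> must be
  0.\<close>

lemma additive_bounded_linear:
  fixes f :: "real \<Rightarrow> real"
  assumes add: "\<And>s h. 0 \<le> s \<Longrightarrow> 0 \<le> h \<Longrightarrow> f (s + h) = f s + f h"
    and \<delta>: "0 < \<delta>" and bdd: "\<And>t. 0 \<le> t \<Longrightarrow> t \<le> \<delta> \<Longrightarrow> \<bar>f t\<bar> \<le> K" and t: "0 \<le> t"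
  shows "f t = t * f 1"
proof -
  define g where "g = (\<lambda>t. f t - t * f 1)"
  have gadd: "g (s + h) = g s + g h" if "0 \<le> s" "0 \<le> h" for s h
    using add[OF that] by (simp add: g_def algebra_simps)
  have gmult: "g (real n * s) = real n * g s" if "0 \<le> s" for n s
  proof (induction n)
    case 0
    then show ?case using gadd[of 0 0] by simp
  next
    case (Suc n)
    then show ?case using gadd[of s "real n * s"] that by (simp add: algebra_simps)
  qed
  have gnat: "g (real n) = 0" for n
    using gmult[of 1 n] by (simp add: g_def)
  \<comment> \<open>With \<open>m * \<delta> >= 1\<close>, dividing by \<open>m\<close> maps
    \<open>[0, 1]\<close> into \<open>[0, \<delta>]\<close>, where the hypothesis bounds
    \<open>f\<close>; multiplicativity of \<open>g\<close> then costs a factor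
    \<open>m\<close>.\<close>
  obtain m :: nat where m: "1 / \<delta> \<le> real m" using real_arch_simple by blast
  have m0: "0 < real m" using m \<delta> by (meson less_le_trans zero_less_divide_1_iff)
  define C where "C = real m * (K + \<bar>f 1\<bar> * \<delta>)"
  have g1: "\<bar>g s\<bar> \<le> C" if "0 \<le> s" "s \<le> 1" for s
  proof -
    have "1 \<le> real m * \<delta>" using m \<delta> by (simp add: divide_le_eq)
    then have "s \<le> \<delta> * real m" using that by (simp add: mult.commute)
    then have small: "0 \<le> s / real m" "s / real m \<le> \<delta>"
      using that m0 by (simp_all add: divide_le_eq)
    have "\<bar>g (s / real m)\<bar> \<le> \<bar>f (s / real m)\<bar> + \<bar>s / real m * f 1\<bar>"
      unfolding g_def by (rule abs_triangle_ineq4)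
    also have "\<dots> \<le> K + \<delta> * \<bar>f 1\<bar>"
    proof (intro add_mono bdd small)
      have "\<bar>s / real m * f 1\<bar> = s / real m * \<bar>f 1\<bar>"
        unfolding abs_mult using small(1) by (simp only: abs_of_nonneg)
      also have "\<dots> \<le> \<delta> * \<bar>f 1\<bar>"
        using small(2) by (intro mult_right_mono) auto
      finally show "\<bar>s / real m * f 1\<bar> \<le> \<delta> * \<bar>f 1\<bar>" .
    qed
    finally have "\<bar>g (s / real m)\<bar> \<le> K + \<bar>f 1\<bar> * \<delta>" by (simp add: mult.commute)
    then have "real m * \<bar>g (s / real m)\<bar> \<le> C"
      using m0 by (simp add: C_def)
    moreover have "g s = real m * g (s / real m)" using gmult[of "s / real m" m] small m0 by simp
    ultimately show ?thesis by (simp add: abs_mult)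
  qed
  have gC: "\<bar>g s\<bar> \<le> C" if "0 \<le> s" for s
  proof -
    define k where "k = nat \<lfloor>s\<rfloor>"
    have k: "0 \<le> s - real k" "s - real k \<le> 1"
      using that unfolding k_def by linarith+
    have "g s = g (real k + (s - real k))" by simp
    also have "\<dots> = g (s - real k)"
      using k(1) by (subst gadd) (auto simp: gnat)
    finally show ?thesis using g1[OF k] by simp
  qed
  have "g t = 0"
  proof (rule ccontr)
    assume "g t \<noteq> 0"
    then obtain n where "C / \<bar>g t\<bar> < real n" using reals_Archimedean2 by blast
    then have "C < real n * \<bar>g t\<bar>" using \<open>g t \<noteq> 0\<close> by (simp add: divide_less_eq)
    also have "\<dots> = \<bar>g (real n * t)\<bar>" using gmult[OF t] by (simp add: abs_mult)
    also have "\<dots> \<le> C" using gC t by simp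
    finally show False by simp
  qed
  then show ?thesis by (simp add: g_def)
qed

lemma (in prob_space) indep_var_indep_vars:
  assumes "indep_vars (\<lambda>_. N) X I" "i \<in> I" "j \<in> I" "i \<noteq> j"
  shows "indep_var N (X i) N (X j)"
proof -
  have "indep_var N ((\<lambda>f. f i) \<circ> (\<lambda>\<omega>. restrict (\<lambda>i. X i \<omega>) {i})) N ((\<lambda>f. f j) \<circ> (\<lambda>\<omega>. restrict (\<lambda>i. X i \<omega>) {j}))"
    using assms by (intro indep_var_compose[OF indep_var_restrict[OF assms(1)]]) auto
  then show ?thesis by (simp add: comp_def)
qed

text \<open>Cancellation between the summands is excluded by restricting to an event
  \<open>|V| <= K\<close> of positive probability. There \<open>U^2\<close> is bounded by an
  integrable function of \<open>U + V\<close>, and independence factors the restricted integral into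
  the second moment of \<open>U\<close> and the probability of the event.\<close>

lemma (in prob_space) square_integrable_indep_summand:
  assumes ind: "indep_var borel U borel V" and UV: "square_integrable M (\<lambda>w. U w + V w)"
  shows "square_integrable M U"
proof -
  have [measurable]: "U \<in> borel_measurable M" "V \<in> borel_measurable M"
    using indep_var_rv1[OF ind] indep_var_rv2[OF ind] by auto
  have "\<exists>K::nat. emeasure M {w \<in> space M. \<bar>V w\<bar> \<le> real K} \<noteq> 0"
  proof (rule ccontr)
    assume "\<not> ?thesis"
    then have "AE w in M. \<forall>K::nat. \<not> \<bar>V w\<bar> \<le> real K"
      by (subst AE_all_countable) (auto intro!: AE_I[where N="{w \<in> space M. \<bar>V w\<bar> \<le> real K}" for K])
    then have "AE w in M. False"
      by eventually_elim (use real_arch_simple in blast)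
    then show False by simp
  qed
  then obtain K :: nat where K: "emeasure M {w \<in> space M. \<bar>V w\<bar> \<le> real K} \<noteq> 0" by blast
  let ?g = "\<lambda>v. indicator {v. \<bar>v\<bar> \<le> real K} v :: ennreal"
  have ind': "indep_vars (\<lambda>_. borel) (case_bool (\<lambda>w. ennreal ((U w)\<^sup>2)) (\<lambda>w. ?g (V w))) UNIV"
  proof -
    have "indep_var borel ((\<lambda>u. ennreal (u\<^sup>2)) \<circ> U) borel (?g \<circ> V)"
      by (rule indep_var_compose[OF ind]) measurable
    moreover have "case_bool borel borel = (\<lambda>_::bool. borel :: ennreal measure)" by (auto simp: fun_eq_iff split: bool.split)
    ultimately show ?thesis by (simp add: indep_var_def comp_def)
  qed
  have "(\<integral>\<^sup>+w. ennreal ((U w)\<^sup>2) \<partial>M) * (\<integral>\<^sup>+w. ?g (V w) \<partial>M) = (\<integral>\<^sup>+w. ennreal ((U w)\<^sup>2) * ?g (V w) \<partial>M)"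
    using indep_vars_nn_integral[OF _ ind'] by (simp add: UNIV_bool mult.commute)
  also have "\<dots> \<le> (\<integral>\<^sup>+w. ennreal (2 * (U w + V w)\<^sup>2 + 2 * (real K)\<^sup>2) \<partial>M)"
  proof (intro nn_integral_mono)
    fix w
    have "(U w)\<^sup>2 \<le> 2 * (U w + V w)\<^sup>2 + 2 * (real K)\<^sup>2" if "\<bar>V w\<bar> \<le> real K"
    proof -
      have "(V w)\<^sup>2 \<le> (real K)\<^sup>2" using that by (metis abs_ge_zero power2_abs power_mono)
      \<comment> \<open>Expanding this square gives
        \<open>U^2 <= 2 (U + V)^2 + 2 V^2\<close>.\<close>
      moreover have "0 \<le> (U w + 2 * V w)\<^sup>2" by simp
      ultimately show ?thesis by (simp add: power2_eq_square algebra_simps)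
    qed
    then show "ennreal ((U w)\<^sup>2) * ?g (V w) \<le> ennreal (2 * (U w + V w)\<^sup>2 + 2 * (real K)\<^sup>2)"
      by (auto simp: indicator_def simp del: ennreal_plus intro!: ennreal_leI)
  qed
  also have "\<dots> < \<infinity>"
  proof -
    have "integrable M (\<lambda>w. 2 * (U w + V w)\<^sup>2 + 2 * (real K)\<^sup>2)"
      using UV by (simp add: square_integrable_def)
    then show ?thesis by (simp add: integrable_iff_bounded)
  qed
  finally have "(\<integral>\<^sup>+w. ennreal ((U w)\<^sup>2) \<partial>M) * (\<integral>\<^sup>+w. ?g (V w) \<partial>M) < \<infinity>" .
  moreover have "(\<integral>\<^sup>+w. ?g (V w) \<partial>M) = emeasure M {w \<in> space M. \<bar>V w\<bar> \<le> real K}"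
  proof -
    have "(\<integral>\<^sup>+w. ?g (V w) \<partial>M) = (\<integral>\<^sup>+w. indicator {w \<in> space M. \<bar>V w\<bar> \<le> real K} w \<partial>M)"
      by (rule nn_integral_cong) (simp add: indicator_def)
    then show ?thesis by simp
  qed
  ultimately have "(\<integral>\<^sup>+w. ennreal ((U w)\<^sup>2) \<partial>M) < \<infinity>"
    using K by (auto simp: ennreal_mult_less_top)
  then show ?thesis by (simp add: square_integrable_iff_nn_integral)
qed

section \<open>Second moments of Levy processes\<close>

lemma borel_measurable_vec_nth:
  fixes f :: "'b \<Rightarrow> 'c::topological_space^'n"
  assumes "f \<in> borel_measurable M"
  shows "(\<lambda>x. f x $ i) \<in> borel_measurable M"
  by (rule measurable_compose[OF assms borel_measurable_continuous_onI]) (intro continuous_intros)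

locale levy = prob_space +
  fixes X :: "real \<Rightarrow> 'a \<Rightarrow> real^'d"
  assumes levy: "levy_process M X"
begin

lemma measurable_levy: "0 \<le> t \<Longrightarrow> X t \<in> borel_measurable M"
  using levy by (simp add: levy_process_def)

lemma measurable_levy_nth: "0 \<le> t \<Longrightarrow> (\<lambda>w. X t w $ i) \<in> borel_measurable M"
  by (intro borel_measurable_vec_nth measurable_levy)

lemma levy_zero: "AE w in M. X 0 w = 0"
  using levy by (simp add: levy_process_def)

text \<open>The first increment keeps the term \<open>X 0\<close>, because the process starts at 0
  only almost surely.\<close>

lemma indep_increments:
  assumes "0 \<le> s" "0 \<le> h"
  shows "indep_var borel (\<lambda>w. X s w $ i - X 0 w $ i) borel (\<lambda>w. X (s + h) w $ j - X s w $ j)"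
proof -
  define t where "t = (\<lambda>n::nat. if n = 0 then 0 else if n = 1 then s else s + h)"
  have "indep_vars (\<lambda>_. borel) (\<lambda>i w. X (t (Suc i)) w - X (t i) w) {..<2}"
  proof -
    have "\<forall>n t. 0 \<le> t 0 \<and> (\<forall>i<n. t i \<le> t (Suc i)) \<longrightarrow>
        indep_vars (\<lambda>_. borel) (\<lambda>i w. X (t (Suc i)) w - X (t i) w) {..<(n::nat)}"
      using levy unfolding levy_process_def by blast
    moreover have "0 \<le> t 0 \<and> (\<forall>i<2. t i \<le> t (Suc i))"
      using assms by (simp add: t_def less_2_cases_iff)
    ultimately show ?thesis by blast
  qed
  from indep_var_indep_vars[OF this, of 0 1]
  have "indep_var borel (\<lambda>w. X s w - X 0 w) borel (\<lambda>w. X (s + h) w - X s w)"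
    by (simp add: t_def)
  from indep_var_compose[OF this borel_measurable_vec_nth[OF measurable_ident, of i] borel_measurable_vec_nth[OF measurable_ident, of j]]
  show ?thesis by (simp add: comp_def)
qed

lemma stationary_increments:
  assumes "0 \<le> s" "0 \<le> h" and f: "f \<in> borel_measurable borel"
  shows "integrable M (\<lambda>w. f (X (s + h) w - X s w) :: real) \<longleftrightarrow> integrable M (\<lambda>w. f (X h w))"
    and "(\<integral>w. f (X (s + h) w - X s w) \<partial>M) = (\<integral>w. f (X h w) \<partial>M)"
proof -
  have m: "(\<lambda>w. X (s + h) w - X s w) \<in> measurable M borel" "X h \<in> measurable M borel"
    using assms by (auto intro!: borel_measurable_diff measurable_levy)
  have d: "distr M borel (\<lambda>w. X (s + h) w - X s w) = distr M borel (X h)"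
    using levy assms by (simp add: levy_process_def)
  show "integrable M (\<lambda>w. f (X (s + h) w - X s w) :: real) \<longleftrightarrow> integrable M (\<lambda>w. f (X h w))"
    using integrable_distr_eq[OF m(1) f] integrable_distr_eq[OF m(2) f] d by simp
  show "(\<integral>w. f (X (s + h) w - X s w) \<partial>M) = (\<integral>w. f (X h w) \<partial>M)"
    using integral_distr[OF m(1) f] integral_distr[OF m(2) f] d by simp
qed

end

locale centered_levy = levy +
  assumes square_integrable_1: "\<And>i. square_integrable M (\<lambda>w. X 1 w $ i)"
    and mean_1: "\<And>i. (\<integral>w. X 1 w $ i \<partial>M) = 0"
begin

text \<open>For \<open>t <= 1\<close> the variable \<open>X 1\<close> is, almost surely, a sum of
  the independent increments over \<open>[0, t]\<close> and \<open>[t, 1]\<close>, so its second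
  moment controls that of \<open>X t\<close>. Later times are reached by unit steps, whose
  increments have the law of \<open>X 1\<close>.\<close>

lemma square_integrable_levy:
  assumes "0 \<le> t"
  shows "square_integrable M (\<lambda>w. X t w $ i)"
proof -
  have incr: "square_integrable M (\<lambda>w. X (s + 1) w $ i - X s w $ i)" if "0 \<le> s" for s
    unfolding square_integrable_def
    using stationary_increments(1)[OF that, of 1 "\<lambda>v. (v $ i)\<^sup>2"] square_integrable_1[of i] that
    by (auto simp: square_integrable_def intro!: borel_measurable_diff measurable_levy_nth)
  have main: "square_integrable M (\<lambda>w. X t w $ i)" if "0 \<le> t" "t \<le> real n + 1" for n t
    using that
  proof (induction n arbitrary: t)
    case 0
    have "square_integrable M (\<lambda>w. (X t w $ i - X 0 w $ i) + (X 1 w $ i - X t w $ i))"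
    proof (rule square_integrable_cong_AE[OF _ _ square_integrable_1[of i]])
      show "AE w in M. X 1 w $ i = (X t w $ i - X 0 w $ i) + (X 1 w $ i - X t w $ i)"
        using levy_zero by eventually_elim simp
    qed (use 0 in \<open>auto intro!: borel_measurable_diff borel_measurable_add measurable_levy_nth\<close>)
    moreover have "indep_var borel (\<lambda>w. X t w $ i - X 0 w $ i) borel (\<lambda>w. X 1 w $ i - X t w $ i)"
      using indep_increments[of t "1 - t" i i] 0 by simp
    ultimately have "square_integrable M (\<lambda>w. X t w $ i - X 0 w $ i)"
      by (rule square_integrable_indep_summand[rotated])
    then show ?case
    proof (rule square_integrable_cong_AE[rotated 2])
      show "AE w in M. X t w $ i - X 0 w $ i = X t w $ i"
        using levy_zero by eventually_elim simp
    qed (use 0 measurable_levy_nth in simp)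
  next
    case (Suc n)
    show ?case
    proof (cases "t \<le> 1")
      case True
      then show ?thesis using Suc by (intro Suc.IH) auto
    next
      case False
      then have "square_integrable M (\<lambda>w. X (t - 1) w $ i + (X (t - 1 + 1) w $ i - X (t - 1) w $ i))"
        using Suc by (intro square_integrable_add incr Suc.IH) auto
      then show ?thesis by simp
    qed
  qed
  obtain n where "t \<le> real n" using real_arch_simple by blast
  then show ?thesis using assms by (intro main[of t n]) auto
qed

lemma integrable_levy: "0 \<le> t \<Longrightarrow> integrable M (\<lambda>w. X t w $ i)"
  by (intro square_integrable_imp_integrable' square_integrable_levy)

lemma mean_add:
  assumes "0 \<le> s" "0 \<le> h"
  shows "(\<integral>w. X (s + h) w $ i \<partial>M) = (\<integral>w. X s w $ i \<partial>M) + (\<integral>w. X h w $ i \<partial>M)"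
proof -
  have "(\<integral>w. X (s + h) w $ i \<partial>M) - (\<integral>w. X s w $ i \<partial>M) = (\<integral>w. (X (s + h) w - X s w) $ i \<partial>M)"
    using assms by (simp add: integrable_levy)
  also have "\<dots> = (\<integral>w. X h w $ i \<partial>M)"
    by (rule stationary_increments(2)[OF assms]) measurable
  finally show ?thesis by simp
qed

lemma integral_prod_increment:
  assumes "0 \<le> s" "0 \<le> h"
  shows "(\<integral>w. X s w $ i * (X (s + h) w $ j - X s w $ j) \<partial>M) = (\<integral>w. X s w $ i \<partial>M) * (\<integral>w. X h w $ j \<partial>M)"
proof -
  have AE: "AE w in M. X s w $ i - X 0 w $ i = X s w $ i"
    using levy_zero by eventually_elim simp
  have "(\<integral>w. X s w $ i * (X (s + h) w $ j - X s w $ j) \<partial>M) =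
      (\<integral>w. (X s w $ i - X 0 w $ i) * (X (s + h) w $ j - X s w $ j) \<partial>M)"
    using assms AE by (intro integral_cong_AE)
      (auto intro!: borel_measurable_times borel_measurable_diff measurable_levy_nth)
  also have "\<dots> = (\<integral>w. X s w $ i - X 0 w $ i \<partial>M) * (\<integral>w. X (s + h) w $ j - X s w $ j \<partial>M)"
    using assms by (intro indep_var_lebesgue_integral indep_increments Bochner_Integration.integrable_diff integrable_levy) auto
  also have "(\<integral>w. X s w $ i - X 0 w $ i \<partial>M) = (\<integral>w. X s w $ i \<partial>M)"
    using assms AE by (intro integral_cong_AE) (auto intro!: borel_measurable_diff measurable_levy_nth)
  also have "(\<integral>w. X (s + h) w $ j - X s w $ j \<partial>M) = (\<integral>w. X h w $ j \<partial>M)"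
    using mean_add[OF assms, of j] assms by (simp add: integrable_levy)
  finally show ?thesis .
qed

text \<open>The products of means are retained because the formula first serves to bound variances,
  before the means are known to vanish.\<close>

lemma second_moment_add:
  assumes "0 \<le> s" "0 \<le> h"
  shows "(\<integral>w. X (s + h) w $ i * X (s + h) w $ j \<partial>M) =
    (\<integral>w. X s w $ i * X s w $ j \<partial>M) + (\<integral>w. X h w $ i * X h w $ j \<partial>M) +
    (\<integral>w. X s w $ i \<partial>M) * (\<integral>w. X h w $ j \<partial>M) + (\<integral>w. X h w $ i \<partial>M) * (\<integral>w. X s w $ j \<partial>M)"
proof -
  let ?D = "\<lambda>i w. X (s + h) w $ i - X s w $ i"
  have D: "square_integrable M (?D i)" "square_integrable M (\<lambda>w. X s w $ i)" for i
    using assms by (auto intro!: square_integrable_diff square_integrable_levy)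
  have "(\<integral>w. X (s + h) w $ i * X (s + h) w $ j \<partial>M) =
      (\<integral>w. X s w $ i * X s w $ j + ?D i w * ?D j w + X s w $ i * ?D j w + X s w $ j * ?D i w \<partial>M)"
    by (simp add: algebra_simps)
  also have "\<dots> = (\<integral>w. X s w $ i * X s w $ j \<partial>M) + (\<integral>w. ?D i w * ?D j w \<partial>M) +
      (\<integral>w. X s w $ i * ?D j w \<partial>M) + (\<integral>w. X s w $ j * ?D i w \<partial>M)"
    by (simp add: square_integrable_mult D)
  also have "(\<integral>w. ?D i w * ?D j w \<partial>M) = (\<integral>w. X h w $ i * X h w $ j \<partial>M)"
    using stationary_increments(2)[OF assms, of "\<lambda>v. v $ i * v $ j"] by simp
  finally show ?thesis by (simp add: integral_prod_increment assms mult.commute)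
qed

text \<open>Independent stationary increments make the variance additive in time, hence monotone.
  This gives a bound uniform in \<open>t\<close> that does not involve the mean.\<close>

lemma variance_bound:
  assumes "0 \<le> t" "t \<le> 1"
  shows "variance (\<lambda>w. X t w $ i) \<le> variance (\<lambda>w. X 1 w $ i)"
proof -
  define v where "v = (\<lambda>t. (\<integral>w. X t w $ i * X t w $ i \<partial>M) - (\<integral>w. X t w $ i \<partial>M) * (\<integral>w. X t w $ i \<partial>M))"
  have var: "variance (\<lambda>w. X t w $ i) = v t" if "0 \<le> t" for t
    using variance_eq[of "\<lambda>w. X t w $ i"] integrable_levy[OF that] square_integrable_levy[OF that]
    by (simp add: v_def square_integrable_def power2_eq_square)
  have "v 1 = v t + v (1 - t)"
    using assms second_moment_add[of t "1 - t" i i] mean_add[of t "1 - t" i]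
    by (simp add: v_def algebra_simps)
  then have "variance (\<lambda>w. X 1 w $ i) = variance (\<lambda>w. X t w $ i) + variance (\<lambda>w. X (1 - t) w $ i)"
    using assms by (simp only: var zero_le_one diff_ge_0_iff_ge)
  moreover have "0 \<le> variance (\<lambda>w. X (1 - t) w $ i)" by (rule variance_positive)
  ultimately show ?thesis by linarith
qed

text \<open>Near time \<open>0\<close>, stochastic continuity and Chebyshev's inequality provide a path value close
  both to \<open>0\<close> and to the mean, so the additive mean function is locally bounded.\<close>

lemma mean_zero:
  assumes t: "0 \<le> t"
  shows "(\<integral>w. X t w $ i \<partial>M) = 0"
proof -
  let ?m = "\<lambda>t. \<integral>w. X t w $ i \<partial>M"
  define V where "V = variance (\<lambda>w. X 1 w $ i)"
  have V: "0 \<le> V" unfolding V_def by (rule variance_positive)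
  \<comment> \<open>With this \<open>C\<close>, Chebyshev's inequality gives probability at most
    \<open>V / (2 * V + 1) < 1 / 2\<close> to a deviation \<open>C\<close> from the mean. Together
    with an event of probability below \<open>1 / 2\<close> it cannot fill the space.\<close>
  define C where "C = sqrt (2 * V + 1)"
  have C: "0 < C" "C\<^sup>2 = 2 * V + 1"
    using V by (auto simp: C_def)
  have "((\<lambda>s. measure M {w \<in> space M. norm (X s w - X 0 w) > 1}) \<longlongrightarrow> 0) (at 0 within {0..})"
    using levy by (simp add: levy_process_def)
  then have "\<forall>\<^sub>F s in at 0 within {0..}. measure M {w \<in> space M. norm (X s w - X 0 w) > 1} < 1 / 2"
    by (rule order_tendstoD) simp
  then obtain \<delta> where \<delta>: "0 < \<delta>" and small:
    "\<And>s. s \<in> {0..} \<Longrightarrow> s \<noteq> 0 \<Longrightarrow> dist s 0 < \<delta> \<Longrightarrow> measure M {w \<in> space M. norm (X s w - X 0 w) > 1} < 1 / 2"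
    unfolding eventually_at by blast
  have "\<bar>?m s\<bar> \<le> 1 + C" if s: "0 \<le> s" "s \<le> min (\<delta> / 2) 1" for s
  proof -
    let ?A = "{w \<in> space M. norm (X s w - X 0 w) > 1}"
    let ?B = "{w \<in> space M. C \<le> \<bar>X s w $ i - ?m s\<bar>}"
    have meas [measurable]: "X s \<in> borel_measurable M" "X 0 \<in> borel_measurable M"
      using s measurable_levy by auto
    have "measure M ?A < 1 / 2"
      using small[of s] s \<delta> by (cases "s = 0") (auto simp: dist_real_def)
    moreover have "measure M ?B < 1 / 2"
    proof -
      have "measure M ?B \<le> variance (\<lambda>w. X s w $ i) / C\<^sup>2"
        using square_integrable_levy[of s i] s C by (intro Chebyshev_inequality) (auto simp: square_integrable_def)
      also have "\<dots> \<le> V / C\<^sup>2"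
        unfolding V_def using variance_bound[of s i] s by (intro divide_right_mono) auto
      also have "\<dots> < 1 / 2"
        using C V by (simp add: divide_less_eq)
      finally show ?thesis .
    qed
    moreover have "measure M (?A \<union> ?B) \<le> measure M ?A + measure M ?B"
      by (rule measure_Un_le) measurable
    ultimately have "measure M (?A \<union> ?B) < 1" by linarith
    \<comment> \<open>A larger mean would force almost every path either away from 0 or away from
      the mean, contradicting the bound below 1 for the union.\<close>
    moreover have "AE w in M. w \<in> ?A \<union> ?B" if neg: "1 + C < \<bar>?m s\<bar>"
      using levy_zero AE_space
    proof eventually_elim
      case (elim w)
      show ?case
      proof (rule ccontr)
        assume "w \<notin> ?A \<union> ?B"
        then have "norm (X s w) \<le> 1" "\<bar>X s w $ i - ?m s\<bar> < C" using elim by auto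
        moreover have "\<bar>X s w $ i\<bar> \<le> norm (X s w)" by (rule component_le_norm_cart)
        ultimately show False using neg by linarith
      qed
    qed
    then have "1 + C < \<bar>?m s\<bar> \<Longrightarrow> measure M (?A \<union> ?B) = 1"
      by (subst prob_eq_1) auto
    ultimately show ?thesis by linarith
  qed
  from additive_bounded_linear[of ?m "min (\<delta> / 2) 1", OF mean_add _ this t] \<delta>
  show ?thesis by (simp add: mean_1)
qed

text \<open>With centered increments the mixed terms vanish, so the moment is additive in time;
  Cauchy-Schwarz and the variance bound make it bounded on \<open>[0, 1]\<close>.\<close>

lemma second_moment_linear:
  assumes t: "0 \<le> t"
  shows "(\<integral>w. X t w $ i * X t w $ j \<partial>M) = t * (\<integral>w. X 1 w $ i * X 1 w $ j \<partial>M)"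
proof (rule additive_bounded_linear[where \<delta> = 1])
  fix s :: real assume s: "0 \<le> s" "s \<le> 1"
  have var: "(\<integral>w. (X t w $ k)\<^sup>2 \<partial>M) = variance (\<lambda>w. X t w $ k)" if "0 \<le> t" for k t
    by (simp add: mean_zero that)
  have "\<bar>\<integral>w. X s w $ i * X s w $ j \<partial>M\<bar> \<le> sqrt (\<integral>w. (X s w $ i)\<^sup>2 \<partial>M) * sqrt (\<integral>w. (X s w $ j)\<^sup>2 \<partial>M)"
    using s by (intro Cauchy_Schwarz_integral square_integrable_levy)
  also have "\<dots> \<le> sqrt (variance (\<lambda>w. X 1 w $ i)) * sqrt (variance (\<lambda>w. X 1 w $ j))"
    using s by (simp only: var) (intro mult_mono real_sqrt_le_mono variance_bound real_sqrt_ge_zero variance_positive)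
  finally show "\<bar>\<integral>w. X s w $ i * X s w $ j \<partial>M\<bar> \<le> sqrt (variance (\<lambda>w. X 1 w $ i)) * sqrt (variance (\<lambda>w. X 1 w $ j))" .
qed (use t in \<open>simp_all add: second_moment_add mean_zero\<close>)

text \<open>The later value is the earlier one plus an independent centered increment, so only the
  second moment at the earlier time remains.\<close>

lemma covariance_levy:
  assumes "0 \<le> s" "0 \<le> t"
  shows "(\<integral>w. X s w $ i * X t w $ j \<partial>M) = min s t * (\<integral>w. X 1 w $ i * X 1 w $ j \<partial>M)"
proof -
  have le: "(\<integral>w. X s w $ i * X t w $ j \<partial>M) = s * (\<integral>w. X 1 w $ i * X 1 w $ j \<partial>M)" if "0 \<le> s" "s \<le> t" for s t i j
  proof -
    have "(\<integral>w. X s w $ i * X t w $ j \<partial>M) = (\<integral>w. X s w $ i * X s w $ j + X s w $ i * (X t w $ j - X s w $ j) \<partial>M)"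
      by (simp add: algebra_simps)
    also have "\<dots> = (\<integral>w. X s w $ i * X s w $ j \<partial>M) + (\<integral>w. X s w $ i * (X t w $ j - X s w $ j) \<partial>M)"
      using that by (intro Bochner_Integration.integral_add square_integrable_mult square_integrable_diff square_integrable_levy) auto
    also have "(\<integral>w. X s w $ i * (X t w $ j - X s w $ j) \<partial>M) = 0"
      using integral_prod_increment[of s "t - s" i j] that by (simp add: mean_zero)
    finally show ?thesis using second_moment_linear[OF that(1)] by simp
  qed
  show ?thesis
  proof (cases "s \<le> t")
    case True
    then show ?thesis using le[of s t i j] assms by simp
  next
    case False
    then show ?thesis using le[of t s j i] assms by (simp add: mult.commute)
  qed
qed

text \<open>One sequence serves all paths at once, which turns the left limit into a sequential
  limit, as needed for measurability and for Fatou's lemma.\<close>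

lemma left_limit_sequence:
  assumes u: "0 < u"
  obtains s where "\<And>n. 0 \<le> s n" "\<And>n. s n < u" "s \<longlonglongrightarrow> u"
    "\<And>w. w \<in> space M \<Longrightarrow> (\<lambda>n. X (s n) w) \<longlonglongrightarrow> Lim (at_left u) (\<lambda>s. X s w)"
proof -
  define s where "s = (\<lambda>n. u - u / (real n + 2))"
  have s: "0 \<le> s n" "s n < u" for n
    using u by (auto simp: s_def field_simps)
  have s_lim: "s \<longlonglongrightarrow> u"
    unfolding s_def using u by real_asymp
  have at: "filterlim s (at_left u) sequentially"
    unfolding filterlim_at using s_lim s(2) by (simp add: less_imp_neq)
  have "(\<lambda>n. X (s n) w) \<longlonglongrightarrow> Lim (at_left u) (\<lambda>s. X s w)" if "w \<in> space M" for w
  proof -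
    have "\<forall>w\<in>space M. \<forall>t>0. \<exists>l. ((\<lambda>s. X s w) \<longlongrightarrow> l) (at_left t)"
      using levy unfolding levy_process_def by blast
    then obtain l where "((\<lambda>s. X s w) \<longlongrightarrow> l) (at_left u)"
      using u \<open>w \<in> space M\<close> by blast
    then show ?thesis
      using filterlim_compose[OF _ at] by (simp add: tendsto_Lim)
  qed
  with s s_lim show ?thesis by (rule that)
qed

lemma measurable_left_limit:
  assumes u: "0 < u"
  shows "(\<lambda>w. Lim (at_left u) (\<lambda>s. X s w)) \<in> borel_measurable M"
proof -
  obtain s where s: "\<And>n. 0 \<le> s n" and
    lim: "\<And>w. w \<in> space M \<Longrightarrow> (\<lambda>n. X (s n) w) \<longlonglongrightarrow> Lim (at_left u) (\<lambda>s. X s w)"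
    using left_limit_sequence[OF u] by metis
  show ?thesis
    by (rule borel_measurable_LIMSEQ_metric[OF measurable_levy[OF s] lim])
qed

text \<open>No jump occurs at a fixed time: the mean square of \<open>X u - X s\<close> is
  proportional to \<open>u - s\<close>, and Fatou's lemma transfers its vanishing to the pathwise
  left limit, component by component.\<close>

lemma left_limit_eq_AE:
  assumes u: "0 < u"
  shows "AE w in M. Lim (at_left u) (\<lambda>s. X s w) = X u w"
proof -
  obtain s where s: "\<And>n. 0 \<le> s n" "\<And>n. s n < u" and s_lim: "s \<longlonglongrightarrow> u" and
    lim: "\<And>w. w \<in> space M \<Longrightarrow> (\<lambda>n. X (s n) w) \<longlonglongrightarrow> Lim (at_left u) (\<lambda>s. X s w)"
    using left_limit_sequence[OF u] by metis
  have "AE w in M. Lim (at_left u) (\<lambda>s. X s w) $ i = X u w $ i" for i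
  proof -
    let ?c = "\<integral>w. X 1 w $ i * X 1 w $ i \<partial>M"
    let ?d = "\<lambda>n w. ennreal ((X u w $ i - X (s n) w $ i)\<^sup>2)"
    have d: "(\<integral>\<^sup>+w. ?d n w \<partial>M) = ennreal ((u - s n) * ?c)" for n
    proof -
      have "square_integrable M (\<lambda>w. X u w $ i - X (s n) w $ i)"
        using s[of n] u by (intro square_integrable_diff square_integrable_levy) auto
      then have "(\<integral>\<^sup>+w. ?d n w \<partial>M) = ennreal (\<integral>w. (X u w $ i - X (s n) w $ i)\<^sup>2 \<partial>M)"
        by (intro nn_integral_eq_integral) (auto simp: square_integrable_def)
      also have "(\<integral>w. (X u w $ i - X (s n) w $ i)\<^sup>2 \<partial>M) = (\<integral>w. (X (u - s n) w $ i)\<^sup>2 \<partial>M)"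
        using stationary_increments(2)[of "s n" "u - s n" "\<lambda>v. (v $ i)\<^sup>2"] s[of n] by simp
      also have "\<dots> = (u - s n) * ?c"
        using second_moment_linear[of "u - s n" i i] s[of n] by (simp add: power2_eq_square)
      finally show ?thesis .
    qed
    have "(\<lambda>n. ennreal ((u - s n) * ?c)) \<longlonglongrightarrow> ennreal ((u - u) * ?c)"
      by (intro tendsto_intros s_lim)
    then have "liminf (\<lambda>n. \<integral>\<^sup>+w. ?d n w \<partial>M) = 0"
      unfolding d by (auto intro: lim_imp_Liminf)
    moreover have "(\<integral>\<^sup>+w. liminf (\<lambda>n. ?d n w) \<partial>M) \<le> liminf (\<lambda>n. \<integral>\<^sup>+w. ?d n w \<partial>M)"
      using s u by (intro nn_integral_liminf) (auto intro!: measurable_compose[OF _ measurable_ennreal] borel_measurable_power borel_measurable_diff measurable_levy_nth)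
    ultimately have "(\<integral>\<^sup>+w. liminf (\<lambda>n. ?d n w) \<partial>M) = 0" by simp
    then have "AE w in M. liminf (\<lambda>n. ?d n w) = 0"
      using s u by (subst (asm) nn_integral_0_iff_AE)
        (auto intro!: borel_measurable_liminf measurable_compose[OF _ measurable_ennreal] borel_measurable_power borel_measurable_diff measurable_levy_nth)
    then show ?thesis
      using AE_space
    proof eventually_elim
      case (elim w)
      have "(\<lambda>n. ?d n w) \<longlonglongrightarrow> ennreal ((X u w $ i - Lim (at_left u) (\<lambda>s. X s w) $ i)\<^sup>2)"
        by (intro tendsto_intros tendsto_vec_nth lim elim)
      then have "liminf (\<lambda>n. ?d n w) = ennreal ((X u w $ i - Lim (at_left u) (\<lambda>s. X s w) $ i)\<^sup>2)"
        by (intro lim_imp_Liminf) auto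
      then show ?case using elim by (simp add: ennreal_eq_0_iff)
    qed
  qed
  then have "AE w in M. \<forall>i. Lim (at_left u) (\<lambda>s. X s w) $ i = X u w $ i"
    by (subst AE_all_countable) auto
  then show ?thesis by eventually_elim (simp add: vec_eq_iff)
qed

end

section \<open>Stochastic integrals\<close>

text \<open>\<open>L\<^sub>t\<close> is the integral of \<open>signed_interval t\<close> against \<open>dL\<close>, for both signs of \<open>t\<close>.\<close>

definition signed_interval :: "real \<Rightarrow> real \<Rightarrow> real"
  where "signed_interval t x = indicator {0<..t} x - indicator {t<..0} x"

lemma signed_interval_diff: "a \<le> b \<Longrightarrow> signed_interval b x - signed_interval a x = indicator {a<..b} x"
  by (auto simp: signed_interval_def indicator_def)

lemma square_integrable_indicator_Ioc: "square_integrable lborel (indicator {a<..b::real} :: real \<Rightarrow> real)"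
proof -
  have "(\<lambda>x. (indicator {a<..b} x :: real)\<^sup>2) = indicator {a<..b}" by (auto simp: indicator_def)
  then show ?thesis
    by (cases "a \<le> b") (simp_all add: square_integrable_def integrable_real_indicator)
qed

lemma square_integrable_signed_interval: "square_integrable lborel (signed_interval t)"
  unfolding signed_interval_def[abs_def] by (intro square_integrable_diff square_integrable_indicator_Ioc)

text \<open>This is the covariance function of two-sided Brownian motion. Times of equal sign share
  the interval up to the smaller modulus, times of opposite sign have disjoint supports.\<close>

lemma signed_interval_inner:
  "(\<integral>x. signed_interval s x * signed_interval t x \<partial>lborel) =
    (if 0 \<le> s \<and> 0 \<le> t then min s t else if s < 0 \<and> t < 0 then min (- s) (- t) else 0)"
proof -
  consider "0 \<le> s" "0 \<le> t" | "s < 0" "t < 0" | "s < 0" "0 \<le> t" | "0 \<le> s" "t < 0" by linarith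
  then show ?thesis
  proof cases
    case 1
    then have "signed_interval s x * signed_interval t x = indicator {0<..min s t} x" for x
      by (auto simp: signed_interval_def indicator_def)
    then show ?thesis using 1 by simp
  next
    case 2
    then have "signed_interval s x * signed_interval t x = indicator {max s t<..0} x" for x
      by (auto simp: signed_interval_def indicator_def)
    then show ?thesis using 2 by (simp add: min_def max_def)
  next
    case 3
    then have zero: "signed_interval s x * signed_interval t x = 0" for x
      by (auto simp: signed_interval_def indicator_def)
    show ?thesis unfolding zero using 3 by simp
  next
    case 4
    then have zero: "signed_interval s x * signed_interval t x = 0" for x
      by (auto simp: signed_interval_def indicator_def)
    show ?thesis unfolding zero using 4 by simp
  qed
qed

lemma step_kernel_Cons_nth:
  "step_kernel ((a, b, C) # xs) s $ i $ k = C $ i $ k * indicator {a<..b} s + step_kernel xs s $ i $ k"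
  by (simp add: step_kernel_def)

lemma square_integrable_step_kernel: "square_integrable lborel (\<lambda>x. step_kernel xs x $ i $ k)"
proof (induction xs)
  case Nil
  then show ?case by (simp add: step_kernel_def square_integrable_zero)
next
  case (Cons x xs)
  obtain a b C where x: "x = (a, b, C)" by (cases x) auto
  show ?case
    unfolding x step_kernel_Cons_nth
    by (intro square_integrable_add square_integrable_cmult square_integrable_indicator_Ioc Cons)
qed

text \<open>Passes from convergence in norm, as in \<open>has_L2_integral\<close>, to convergence of
  single entries, for which the scalar lemmas are stated.\<close>

lemma nn_integral_component_tendsto:
  fixes f :: "nat \<Rightarrow> 'b \<Rightarrow> 'c::real_normed_vector" and g :: "nat \<Rightarrow> 'b \<Rightarrow> real"
  assumes "(\<lambda>n. \<integral>\<^sup>+x. ennreal ((norm (f n x))\<^sup>2) \<partial>N) \<longlonglongrightarrow> 0" and "\<And>n x. \<bar>g n x\<bar> \<le> norm (f n x)"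
  shows "(\<lambda>n. \<integral>\<^sup>+x. ennreal ((g n x)\<^sup>2) \<partial>N) \<longlonglongrightarrow> 0"
proof (rule tendsto_sandwich[OF _ _ tendsto_const assms(1)])
  show "\<forall>\<^sub>F n in sequentially. (\<integral>\<^sup>+x. ennreal ((g n x)\<^sup>2) \<partial>N) \<le> (\<integral>\<^sup>+x. ennreal ((norm (f n x))\<^sup>2) \<partial>N)"
    using assms(2) by (intro always_eventually allI nn_integral_mono ennreal_leI abs_le_square_iff[THEN iffD1]) simp
qed simp

section \<open>Covariances of the two-sided process\<close>

locale levy_pair = X1: centered_levy M X1 + X2: levy M X2
  for M :: "'w measure" and X1 X2 :: "real \<Rightarrow> 'w \<Rightarrow> real^'d" +
  assumes iid: "iid_processes M X1 X2"
begin

text \<open>Evaluation at \<open>t\<close> is measurable on the path space and pushes the common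
  path law to the law at time \<open>t\<close>. In this way the moment assumptions on
  \<open>X1\<close> pass to \<open>X2\<close>.\<close>

lemma same_law:
  assumes "0 \<le> t"
  shows "distr M borel (X1 t) = distr M borel (X2 t)"
proof -
  let ?S = "\<Pi>\<^sub>M t\<in>{0..}. borel :: (real^'d) measure"
  let ?path = "\<lambda>Z w. \<lambda>t\<in>{0::real..}. Z t w :: real^'d"
  have ind: "X1.indep_var ?S (?path X1) ?S (?path X2)" and eq: "distr M ?S (?path X1) = distr M ?S (?path X2)"
    using iid by (simp_all add: iid_processes_def Let_def)
  have "distr (distr M ?S (?path Z)) borel (\<lambda>f. f t) = distr M borel (Z t)"
    if "?path Z \<in> measurable M ?S" for Z
    using assms that by (subst distr_distr) (auto simp: comp_def)
  from this[OF X1.indep_var_rv1[OF ind]] this[OF X1.indep_var_rv2[OF ind]] show ?thesis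
    by (simp add: eq)
qed

lemma integral_same_law:
  assumes "0 \<le> t" "f \<in> borel_measurable borel"
  shows "(\<integral>w. f (X2 t w) \<partial>M) = (\<integral>w. f (X1 t w) \<partial>M :: real)"
    and "integrable M (\<lambda>w. f (X2 t w)) \<longleftrightarrow> integrable M (\<lambda>w. f (X1 t w))"
  using integral_distr[OF X1.measurable_levy[OF assms(1)] assms(2)]
    integral_distr[OF X2.measurable_levy[OF assms(1)] assms(2)]
    integrable_distr_eq[OF X1.measurable_levy[OF assms(1)] assms(2)]
    integrable_distr_eq[OF X2.measurable_levy[OF assms(1)] assms(2)]
    same_law[OF assms(1)] by simp_all

sublocale X2: centered_levy M X2
proof
  show "square_integrable M (\<lambda>w. X2 1 w $ i)" for i
    using X1.square_integrable_1[of i] X2.measurable_levy_nth[of 1 i]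
      integral_same_law(2)[of 1 "\<lambda>v. (v $ i)\<^sup>2"] by (simp add: square_integrable_def)
  show "(\<integral>w. X2 1 w $ i \<partial>M) = 0" for i
    using X1.mean_1[of i] integral_same_law(1)[of 1 "\<lambda>v. v $ i"] by simp
qed

text \<open>An entry of the covariance matrix at time 1, as the mean there is 0.\<close>

definition cov :: "'d \<Rightarrow> 'd \<Rightarrow> real"
  where "cov i j = (\<integral>w. X1 1 w $ i * X1 1 w $ j \<partial>M)"

lemma cov_X2: "(\<integral>w. X2 1 w $ i * X2 1 w $ j \<partial>M) = cov i j"
  unfolding cov_def using integral_same_law(1)[of 1 "\<lambda>v. v $ i * v $ j"] by simp

text \<open>Independence of the two path maps is inherited by coordinates, so the integral factors
  into means, which vanish.\<close>

lemma covariance_cross: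
  assumes "0 \<le> s" "0 \<le> t"
  shows "(\<integral>w. X1 s w $ i * X2 t w $ j \<partial>M) = 0"
proof -
  let ?S = "\<Pi>\<^sub>M t\<in>{0..}. borel :: (real^'d) measure"
  let ?path = "\<lambda>Z w. \<lambda>t\<in>{0::real..}. Z t w :: real^'d"
  have ind: "X1.indep_var ?S (?path X1) ?S (?path X2)"
    using iid by (simp add: iid_processes_def Let_def)
  have m: "(\<lambda>f. f t $ i) \<in> borel_measurable ?S" if "0 \<le> t" for t i
    using that by (intro borel_measurable_vec_nth measurable_component_singleton) auto
  have "X1.indep_var borel (\<lambda>w. X1 s w $ i) borel (\<lambda>w. X2 t w $ j)"
    using X1.indep_var_compose[OF ind m[OF assms(1), of i] m[OF assms(2), of j]] assms
    by (simp add: comp_def)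
  then show ?thesis
    using assms by (simp add: X1.indep_var_lebesgue_integral X1.integrable_levy X2.integrable_levy X1.mean_zero)
qed

abbreviation L :: "real \<Rightarrow> 'w \<Rightarrow> real^'d"
  where "L \<equiv> two_sided X1 X2"

text \<open>The exceptional set may depend on \<open>t\<close>; this is harmless because only
  moments at finitely many fixed times are taken.\<close>

lemma two_sided_AE: "AE w in M. L t w = (if 0 \<le> t then X1 t w else - X2 (- t) w)"
proof (cases "0 \<le> t")
  case False
  then have "AE w in M. Lim (at_left (- t)) (\<lambda>s. X2 s w) = X2 (- t) w"
    by (intro X2.left_limit_eq_AE) simp
  then show ?thesis by eventually_elim (simp add: two_sided_def False)
qed (simp add: two_sided_def)

lemma measurable_two_sided: "L t \<in> borel_measurable M"
proof (cases "0 \<le> t")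
  case True
  then have "L t = X1 t" by (simp add: two_sided_def fun_eq_iff)
  then show ?thesis using X1.measurable_levy[OF True] by simp
next
  case False
  then have "L t = (\<lambda>w. - Lim (at_left (- t)) (\<lambda>s. X2 s w))" by (simp add: two_sided_def fun_eq_iff)
  then show ?thesis using X2.measurable_left_limit[of "- t"] False by simp
qed

lemma square_integrable_two_sided: "square_integrable M (\<lambda>w. L t w $ i)"
proof (rule square_integrable_cong_AE)
  show "AE w in M. (if 0 \<le> t then X1 t w else - X2 (- t) w) $ i = L t w $ i"
    using two_sided_AE[of t] by eventually_elim simp
  show "(\<lambda>w. L t w $ i) \<in> borel_measurable M"
    by (intro borel_measurable_vec_nth measurable_two_sided)
  show "square_integrable M (\<lambda>w. (if 0 \<le> t then X1 t w else - X2 (- t) w) $ i)"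
    using X1.square_integrable_levy[of t i] square_integrable_minus[OF X2.square_integrable_levy[of "- t" i]]
    by (cases "0 \<le> t") auto
qed

text \<open>For two negative times the minus signs cancel; for opposite signs, independence of the
  halves on the left matches disjoint supports on the right.\<close>

lemma covariance_two_sided:
  "(\<integral>w. L s w $ i * L t w $ j \<partial>M) = cov i j * (\<integral>x. signed_interval s x * signed_interval t x \<partial>lborel)"
proof -
  let ?V = "\<lambda>t w. if 0 \<le> t then X1 t w else - X2 (- t) w"
  have "(\<integral>w. L s w $ i * L t w $ j \<partial>M) = (\<integral>w. ?V s w $ i * ?V t w $ j \<partial>M)"
  proof (rule integral_cong_AE)
    show "AE w in M. L s w $ i * L t w $ j = ?V s w $ i * ?V t w $ j"
      using two_sided_AE[of s] two_sided_AE[of t] by eventually_elim simp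
    have V: "(\<lambda>w. ?V t w $ i) \<in> borel_measurable M" for t i
      using X1.measurable_levy_nth[of t i] X2.measurable_levy_nth[of "- t" i] by (cases "0 \<le> t") auto
    show "(\<lambda>w. ?V s w $ i * ?V t w $ j) \<in> borel_measurable M"
      by (intro borel_measurable_times V)
    show "(\<lambda>w. L s w $ i * L t w $ j) \<in> borel_measurable M"
      by (intro borel_measurable_times borel_measurable_vec_nth measurable_two_sided)
  qed
  also have "\<dots> = cov i j * (\<integral>x. signed_interval s x * signed_interval t x \<partial>lborel)"
  proof -
    consider "0 \<le> s" "0 \<le> t" | "s < 0" "t < 0" | "s < 0" "0 \<le> t" | "0 \<le> s" "t < 0" by linarith
    then show ?thesis
    proof cases
      case 1
      then show ?thesis using X1.covariance_levy[of s t i j] by (simp add: signed_interval_inner cov_def)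
    next
      case 2
      then show ?thesis using X2.covariance_levy[of "- s" "- t" i j] by (simp add: signed_interval_inner cov_X2)
    next
      case 3
      then show ?thesis using covariance_cross[of t "- s" j i] by (simp add: signed_interval_inner mult.commute)
    next
      case 4
      then show ?thesis using covariance_cross[of s "- t" i j] by (simp add: signed_interval_inner)
    qed
  qed
  finally show ?thesis .
qed

text \<open>Bilinear expansion through signed intervals treats intervals to the left of 0, to the
  right of 0 and across 0 alike.\<close>

lemma covariance_increments:
  assumes "a \<le> b" "c \<le> d"
  shows "(\<integral>w. (L b w $ i - L a w $ i) * (L d w $ j - L c w $ j) \<partial>M) =
    cov i j * (\<integral>x. indicator {a<..b} x * indicator {c<..d} x \<partial>lborel)"
proof -
  let ?I = "\<lambda>s t. \<integral>x. signed_interval s x * signed_interval t x \<partial>lborel"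
  note prod = square_integrable_mult[OF square_integrable_two_sided square_integrable_two_sided]
    square_integrable_mult[OF square_integrable_signed_interval square_integrable_signed_interval]
  have "(\<integral>w. (L b w $ i - L a w $ i) * (L d w $ j - L c w $ j) \<partial>M) =
      (\<integral>w. L b w $ i * L d w $ j - L b w $ i * L c w $ j - L a w $ i * L d w $ j + L a w $ i * L c w $ j \<partial>M)"
    by (simp add: algebra_simps)
  also have "\<dots> = cov i j * (?I b d - ?I b c - ?I a d + ?I a c)"
    by (simp add: prod covariance_two_sided algebra_simps)
  also have "?I b d - ?I b c - ?I a d + ?I a c = (\<integral>x. signed_interval b x * signed_interval d x -
      signed_interval b x * signed_interval c x - signed_interval a x * signed_interval d x +
      signed_interval a x * signed_interval c x \<partial>lborel)"
    by (simp add: prod)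
  also have "\<dots> = (\<integral>x. (signed_interval b x - signed_interval a x) * (signed_interval d x - signed_interval c x) \<partial>lborel)"
    by (simp add: algebra_simps)
  finally show ?thesis by (simp only: signed_interval_diff assms)
qed

section \<open>The isometry for step functions and their limits\<close>

lemma step_integral_Cons_nth:
  "step_integral L ((a, b, C) # xs) w $ i = (\<Sum>k\<in>UNIV. C $ i $ k * (L b w $ k - L a w $ k)) + step_integral L xs w $ i"
  by (simp add: step_integral_def matrix_vector_mult_def)

lemma square_integrable_step_integral: "square_integrable M (\<lambda>w. step_integral L xs w $ i)"
proof (induction xs)
  case Nil
  then show ?case by (simp add: step_integral_def square_integrable_zero)
next
  case (Cons x xs)
  obtain a b C where x: "x = (a, b, C)" by (cases x) auto
  show ?case
    unfolding x step_integral_Cons_nth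
    by (intro square_integrable_add square_integrable_sum square_integrable_cmult square_integrable_diff
        square_integrable_two_sided Cons)
qed

text \<open>The functions \<open>\<phi> k\<close> represent the correlation of a fixed
  \<open>V\<close> with the increments of the \<open>k\<close>-th component. Leaving
  \<open>V\<close> general lets one induction treat both arguments of the isometry in turn.\<close>

lemma step_integral_inner:
  assumes V: "square_integrable M V" and \<phi>: "\<And>k. square_integrable lborel (\<phi> k)"
    and incr: "\<And>a b k. a \<le> b \<Longrightarrow> (\<integral>w. (L b w $ k - L a w $ k) * V w \<partial>M) = (\<integral>x. indicator {a<..b} x * \<phi> k x \<partial>lborel)"
    and xs: "\<forall>(a, b, C)\<in>set xs. a \<le> b"
  shows "(\<integral>w. step_integral L xs w $ i * V w \<partial>M) = (\<Sum>k\<in>UNIV. \<integral>x. step_kernel xs x $ i $ k * \<phi> k x \<partial>lborel)"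
  using xs
proof (induction xs)
  case Nil
  then show ?case by (simp add: step_integral_def step_kernel_def)
next
  case (Cons x xs)
  obtain a b C where x: "x = (a, b, C)" by (cases x) auto
  have ab: "a \<le> b" using Cons.prems x by auto
  have i1: "integrable M (\<lambda>w. (L b w $ k - L a w $ k) * V w)" for k
    by (intro square_integrable_mult square_integrable_diff square_integrable_two_sided V)
  have i2: "integrable M (\<lambda>w. step_integral L xs w $ i * V w)"
    by (intro square_integrable_mult square_integrable_step_integral V)
  have j1: "integrable lborel (\<lambda>x. indicator {a<..b} x * \<phi> k x)" for k
    by (intro square_integrable_mult square_integrable_indicator_Ioc \<phi>)
  have j2: "integrable lborel (\<lambda>x. step_kernel xs x $ i $ k * \<phi> k x)" for k
    by (intro square_integrable_mult square_integrable_step_kernel \<phi>)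
  have "(\<integral>w. step_integral L (x # xs) w $ i * V w \<partial>M) =
      (\<integral>w. (\<Sum>k\<in>UNIV. C $ i $ k * ((L b w $ k - L a w $ k) * V w)) + step_integral L xs w $ i * V w \<partial>M)"
    unfolding x step_integral_Cons_nth by (simp add: distrib_right sum_distrib_right mult.assoc)
  also have "\<dots> = (\<Sum>k\<in>UNIV. C $ i $ k * (\<integral>w. (L b w $ k - L a w $ k) * V w \<partial>M)) + (\<integral>w. step_integral L xs w $ i * V w \<partial>M)"
    using i1 i2 by (subst Bochner_Integration.integral_add) auto
  also have "\<dots> = (\<Sum>k\<in>UNIV. C $ i $ k * (\<integral>x. indicator {a<..b} x * \<phi> k x \<partial>lborel) + (\<integral>x. step_kernel xs x $ i $ k * \<phi> k x \<partial>lborel))"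
    using Cons by (simp add: incr[OF ab] sum.distrib)
  also have "\<dots> = (\<Sum>k\<in>UNIV. \<integral>y. step_kernel (x # xs) y $ i $ k * \<phi> k y \<partial>lborel)"
  proof (rule sum.cong[OF refl])
    fix k
    have "(\<integral>y. step_kernel (x # xs) y $ i $ k * \<phi> k y \<partial>lborel) =
        (\<integral>y. C $ i $ k * (indicator {a<..b} y * \<phi> k y) + step_kernel xs y $ i $ k * \<phi> k y \<partial>lborel)"
      unfolding x step_kernel_Cons_nth by (simp add: distrib_right mult.assoc)
    also have "\<dots> = C $ i $ k * (\<integral>x. indicator {a<..b} x * \<phi> k x \<partial>lborel) + (\<integral>x. step_kernel xs x $ i $ k * \<phi> k x \<partial>lborel)"
      by (subst Bochner_Integration.integral_add) (use j1 j2 in auto)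
    finally show "C $ i $ k * (\<integral>x. indicator {a<..b} x * \<phi> k x \<partial>lborel) + (\<integral>x. step_kernel xs x $ i $ k * \<phi> k x \<partial>lborel)
        = (\<integral>y. step_kernel (x # xs) y $ i $ k * \<phi> k y \<partial>lborel)" ..
  qed
  finally show ?case .
qed

lemma step_integral_isometry:
  assumes xs: "\<forall>(a, b, C)\<in>set xs. a \<le> b" and ys: "\<forall>(a, b, C)\<in>set ys. a \<le> b"
  shows "(\<integral>w. step_integral L xs w $ i * step_integral L ys w $ j \<partial>M) =
    (\<Sum>k\<in>UNIV. \<Sum>l\<in>UNIV. cov k l * (\<integral>x. step_kernel xs x $ i $ k * step_kernel ys x $ j $ l \<partial>lborel))"
proof -
  have sq: "square_integrable lborel (\<lambda>x. \<Sum>l\<in>UNIV. cov k l * step_kernel ys x $ j $ l)" for k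
    by (intro square_integrable_sum square_integrable_cmult square_integrable_step_kernel)
  \<comment> \<open>The second argument \<open>ys\<close> is expanded first, against a single
    increment; the result is the representation required for expanding \<open>xs\<close>.\<close>
  have incr: "(\<integral>w. (L b w $ k - L a w $ k) * step_integral L ys w $ j \<partial>M) =
      (\<integral>x. indicator {a<..b} x * (\<Sum>l\<in>UNIV. cov k l * step_kernel ys x $ j $ l) \<partial>lborel)" if "a \<le> b" for a b k
  proof -
    have "(\<integral>w. step_integral L ys w $ j * (L b w $ k - L a w $ k) \<partial>M) =
        (\<Sum>l\<in>UNIV. \<integral>x. step_kernel ys x $ j $ l * (cov k l * indicator {a<..b} x) \<partial>lborel)"
    proof (rule step_integral_inner[OF _ _ _ ys])
      show "square_integrable M (\<lambda>w. L b w $ k - L a w $ k)"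
        by (intro square_integrable_diff square_integrable_two_sided)
      show "square_integrable lborel (\<lambda>x. cov k l * indicator {a<..b} x)" for l
        by (intro square_integrable_cmult square_integrable_indicator_Ioc)
      show "(\<integral>w. (L d w $ l - L c w $ l) * (L b w $ k - L a w $ k) \<partial>M) =
          (\<integral>x. indicator {c<..d} x * (cov k l * indicator {a<..b} x) \<partial>lborel)" if "c \<le> d" for c d l
      proof -
        have "(\<integral>x. indicator {c<..d} x * (cov k l * indicator {a<..b} x) \<partial>lborel) =
            (\<integral>x. cov k l * (indicator {a<..b} x * indicator {c<..d} x) \<partial>lborel)"
          by (simp only: mult_ac)
        also have "\<dots> = cov k l * (\<integral>x. indicator {a<..b} x * indicator {c<..d} x \<partial>lborel)"
          by (rule integral_mult_right_zero)
        finally show ?thesis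
          using covariance_increments[OF \<open>a \<le> b\<close> that, of k l] by (simp only: mult.commute)
      qed
    qed
    also have "\<dots> = (\<integral>x. (\<Sum>l\<in>UNIV. step_kernel ys x $ j $ l * (cov k l * indicator {a<..b} x)) \<partial>lborel)"
      by (intro Bochner_Integration.integral_sum[symmetric] square_integrable_mult square_integrable_step_kernel
          square_integrable_cmult square_integrable_indicator_Ioc)
    finally show ?thesis by (simp add: sum_distrib_left mult_ac)
  qed
  have "(\<integral>w. step_integral L xs w $ i * step_integral L ys w $ j \<partial>M) =
      (\<Sum>k\<in>UNIV. \<integral>x. step_kernel xs x $ i $ k * (\<Sum>l\<in>UNIV. cov k l * step_kernel ys x $ j $ l) \<partial>lborel)"
    by (rule step_integral_inner[OF square_integrable_step_integral sq incr xs])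
  also have "\<dots> = (\<Sum>k\<in>UNIV. \<Sum>l\<in>UNIV. cov k l * (\<integral>x. step_kernel xs x $ i $ k * step_kernel ys x $ j $ l \<partial>lborel))"
  proof (rule sum.cong[OF refl])
    fix k
    have "(\<integral>x. step_kernel xs x $ i $ k * (\<Sum>l\<in>UNIV. cov k l * step_kernel ys x $ j $ l) \<partial>lborel) =
        (\<integral>x. (\<Sum>l\<in>UNIV. cov k l * (step_kernel xs x $ i $ k * step_kernel ys x $ j $ l)) \<partial>lborel)"
      by (simp add: sum_distrib_left mult_ac)
    also have "\<dots> = (\<Sum>l\<in>UNIV. cov k l * (\<integral>x. step_kernel xs x $ i $ k * step_kernel ys x $ j $ l \<partial>lborel))"
      by (subst Bochner_Integration.integral_sum)
        (auto intro!: integrable_mult_right square_integrable_mult square_integrable_step_kernel)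
    finally show "(\<integral>x. step_kernel xs x $ i $ k * (\<Sum>l\<in>UNIV. cov k l * step_kernel ys x $ j $ l) \<partial>lborel) =
        (\<Sum>l\<in>UNIV. cov k l * (\<integral>x. step_kernel xs x $ i $ k * step_kernel ys x $ j $ l \<partial>lborel))" .
  qed
  finally show ?thesis .
qed

text \<open>Both sides are continuous under \<open>L^2\<close> limits, so the identity passes from
  step functions to \<open>h\<close> and \<open>h'\<close>, whose approximating sequences are chosen
  independently of each other.\<close>

lemma L2_integral_isometry:
  fixes h h' :: "real \<Rightarrow> real^'d^'m" and Z Z' :: "'w \<Rightarrow> real^'m"
  assumes Z: "has_L2_integral M L h Z" and Z': "has_L2_integral M L h' Z'"
  shows "(\<integral>w. Z w $ i * Z' w $ j \<partial>M) =
    (\<Sum>k\<in>UNIV. \<Sum>l\<in>UNIV. cov k l * (\<integral>x. h x $ i $ k * h' x $ j $ l \<partial>lborel))"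
    and "square_integrable lborel (\<lambda>x. h x $ i $ k)"
proof -
  have comp: "\<bar>u $ i - v $ i\<bar> \<le> norm (u - v)" for u v :: "real^'n" and i :: 'n
    using component_le_norm_cart[of "u - v" i] by simp
  have comp2: "\<bar>u $ i $ j - v $ i $ j\<bar> \<le> norm (u - v)" for u v :: "real^'n^'m" and i :: 'm and j :: 'n
    using component_le_norm_cart[of "(u - v) $ i" j] Finite_Cartesian_Product.norm_nth_le[of "u - v" i] by simp
  have unpack: "\<exists>xs. (\<forall>n. \<forall>(a, b, C)\<in>set (xs n). a \<le> b) \<and>
      (\<forall>i k. (\<lambda>n. \<integral>\<^sup>+x. ennreal ((step_kernel (xs n) x $ i $ k - h x $ i $ k)\<^sup>2) \<partial>lborel) \<longlonglongrightarrow> 0) \<and>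
      (\<forall>i. (\<lambda>n. \<integral>\<^sup>+w. ennreal ((step_integral L (xs n) w $ i - Z w $ i)\<^sup>2) \<partial>M) \<longlonglongrightarrow> 0)"
    if "has_L2_integral M L h Z" for h :: "real \<Rightarrow> real^'d^'m" and Z
  proof -
    from that obtain xs where xs: "\<forall>n. \<forall>(a, b, C)\<in>set (xs n). a \<le> b"
      "(\<lambda>n. \<integral>\<^sup>+ s. ennreal ((norm (step_kernel (xs n) s - h s))\<^sup>2) \<partial>lborel) \<longlonglongrightarrow> 0"
      "(\<lambda>n. \<integral>\<^sup>+ w. ennreal ((norm (step_integral L (xs n) w - Z w))\<^sup>2) \<partial>M) \<longlonglongrightarrow> 0"
      unfolding has_L2_integral_def by blast
    show ?thesis
      by (intro exI[of _ xs] conjI xs(1) allI nn_integral_component_tendsto[OF xs(2)]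
          nn_integral_component_tendsto[OF xs(3)] comp comp2)
  qed
  obtain xs where xs: "\<And>n. \<forall>(a, b, C)\<in>set (xs n). a \<le> b"
    "\<And>i k. (\<lambda>n. \<integral>\<^sup>+x. ennreal ((step_kernel (xs n) x $ i $ k - h x $ i $ k)\<^sup>2) \<partial>lborel) \<longlonglongrightarrow> 0"
    "\<And>i. (\<lambda>n. \<integral>\<^sup>+w. ennreal ((step_integral L (xs n) w $ i - Z w $ i)\<^sup>2) \<partial>M) \<longlonglongrightarrow> 0"
    using unpack[OF Z] by blast
  obtain ys where ys: "\<And>n. \<forall>(a, b, C)\<in>set (ys n). a \<le> b"
    "\<And>i k. (\<lambda>n. \<integral>\<^sup>+x. ennreal ((step_kernel (ys n) x $ i $ k - h' x $ i $ k)\<^sup>2) \<partial>lborel) \<longlonglongrightarrow> 0"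
    "\<And>i. (\<lambda>n. \<integral>\<^sup>+w. ennreal ((step_integral L (ys n) w $ i - Z' w $ i)\<^sup>2) \<partial>M) \<longlonglongrightarrow> 0"
    using unpack[OF Z'] by blast
  have mZ: "(\<lambda>w. Z w $ i) \<in> borel_measurable M" "(\<lambda>w. Z' w $ i) \<in> borel_measurable M" for i
    using Z Z' by (auto simp: has_L2_integral_def intro!: borel_measurable_vec_nth)
  have mh: "(\<lambda>x. h x $ i $ k) \<in> borel_measurable lborel" "(\<lambda>x. h' x $ i $ k) \<in> borel_measurable lborel" for i k
    using Z Z' by (auto simp: has_L2_integral_def intro!: borel_measurable_vec_nth)
  show "square_integrable lborel (\<lambda>x. h x $ i $ k)"
    by (rule L2_limit_square_integrable(1)[OF square_integrable_step_kernel mh(1) xs(2)])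
  have "(\<lambda>n. \<integral>w. step_integral L (xs n) w $ i * step_integral L (ys n) w $ j \<partial>M) \<longlonglongrightarrow> (\<integral>w. Z w $ i * Z' w $ j \<partial>M)"
    by (rule L2_limit_inner[OF square_integrable_step_integral mZ(1) xs(3) square_integrable_step_integral mZ(2) ys(3)])
  moreover have "(\<lambda>n. \<Sum>k\<in>UNIV. \<Sum>l\<in>UNIV. cov k l * (\<integral>x. step_kernel (xs n) x $ i $ k * step_kernel (ys n) x $ j $ l \<partial>lborel))
      \<longlonglongrightarrow> (\<Sum>k\<in>UNIV. \<Sum>l\<in>UNIV. cov k l * (\<integral>x. h x $ i $ k * h' x $ j $ l \<partial>lborel))"
    by (intro tendsto_sum tendsto_mult tendsto_const
        L2_limit_inner[OF square_integrable_step_kernel mh(1) xs(2) square_integrable_step_kernel mh(2) ys(2)])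
  ultimately show "(\<integral>w. Z w $ i * Z' w $ j \<partial>M) =
    (\<Sum>k\<in>UNIV. \<Sum>l\<in>UNIV. cov k l * (\<integral>x. h x $ i $ k * h' x $ j $ l \<partial>lborel))"
    unfolding step_integral_isometry[OF xs(1) ys(1)] by (rule LIMSEQ_unique)
qed

end

section \<open>The MCARMA process\<close>

lemma bounded_linear_mat_scale_left: "bounded_linear (\<lambda>c::complex. c *\<^sub>M (A :: complex^'n^'m))"
proof (rule linear_conv_bounded_linear[THEN iffD1], rule linearI)
  show "(c + d) *\<^sub>M A = c *\<^sub>M A + d *\<^sub>M A" for c d
    by (simp add: mat_scale_def vec_eq_iff distrib_right)
  show "(r *\<^sub>R c) *\<^sub>M A = r *\<^sub>R c *\<^sub>M A" for r c
    by (simp add: mat_scale_def vec_eq_iff)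
qed

lemma truncated_fourier_matrix:
  fixes \<rho> :: "nat \<Rightarrow> complex^'d^'d"
  assumes neg: "\<And>l. l \<in> {1..n} \<Longrightarrow> Re (lam l) < 0"
  shows "(LINT x:{-N..N}|lborel. exp (\<i> * of_real (t * x)) *\<^sub>M (\<Sum>l=1..n. (1 / (\<i> * of_real x - lam l)) *\<^sub>M \<rho> l)) =
    (\<Sum>l=1..n. (LINT x:{-N..N}|lborel. exp (\<i> * of_real (t * x)) / (\<i> * of_real x - lam l)) *\<^sub>M \<rho> l)"
proof -
  let ?f = "\<lambda>l x. exp (\<i> * of_real (t * x)) / (\<i> * of_real x - lam l)"
  have int: "integrable lborel (\<lambda>x. indicator {-N..N} x *\<^sub>R ?f l x)" if "l \<in> {1..n}" for l
  proof -
    have "\<i> * of_real x - lam l \<noteq> 0" for x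
    proof
      assume "\<i> * of_real x - lam l = 0"
      then have "Re (\<i> * of_real x - lam l) = 0" by simp
      then show False using neg[OF that] by simp
    qed
    then have "set_integrable lborel {-N..N} (?f l)"
      by (intro borel_integrable_atLeastAtMost' continuous_intros) auto
    then show ?thesis by (simp add: set_integrable_def)
  qed
  have "(LINT x:{-N..N}|lborel. exp (\<i> * of_real (t * x)) *\<^sub>M (\<Sum>l=1..n. (1 / (\<i> * of_real x - lam l)) *\<^sub>M \<rho> l)) =
      (\<integral>x. (\<Sum>l=1..n. (indicator {-N..N} x *\<^sub>R ?f l x) *\<^sub>M \<rho> l) \<partial>lborel)"
    unfolding set_lebesgue_integral_def
    by (intro Bochner_Integration.integral_cong refl)
      (simp add: mat_scale_def vec_eq_iff sum_distrib_left scaleR_sum_right mult.assoc)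
  also have "\<dots> = (\<Sum>l=1..n. (\<integral>x. (indicator {-N..N} x *\<^sub>R ?f l x) *\<^sub>M \<rho> l \<partial>lborel))"
    by (intro Bochner_Integration.integral_sum integrable_bounded_linear[OF bounded_linear_mat_scale_left] int)
  also have "\<dots> = (\<Sum>l=1..n. (LINT x:{-N..N}|lborel. ?f l x) *\<^sub>M \<rho> l)"
    unfolding set_lebesgue_integral_def
    by (intro sum.cong refl integral_bounded_linear[OF bounded_linear_mat_scale_left] int)
  finally show ?thesis .
qed

text \<open>The \<open>L\<^sup>2\<close> limit is identified through Fatou's lemma, because the truncated integrals converge
  pointwise off \<open>0\<close>; no Plancherel theorem is needed.\<close>

lemma mcarma_kernel_AE:
  fixes \<rho> :: "nat \<Rightarrow> complex^'d^'d"
  assumes ker: "mcarma_kernel P Q g"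
    and PQ: "\<And>x::real. matrix_inv (P (\<i> * of_real x)) ** Q (\<i> * of_real x) = (\<Sum>l=1..n. (1 / (\<i> * of_real x - lam l)) *\<^sub>M \<rho> l)"
    and neg: "\<And>l. l \<in> {1..n} \<Longrightarrow> Re (lam l) < 0"
  shows "AE t in lborel. t > 0 \<longrightarrow> cmat (g t) = (\<Sum>l=1..n. exp (lam l * of_real t) *\<^sub>M \<rho> l)"
proof -
  define I where "I = (\<lambda>N t. (1 / (2 * pi)) *\<^sub>R
    (\<Sum>l=1..n. (LINT x:{-N..N}|lborel. exp (\<i> * of_real (t * x)) / (\<i> * of_real x - lam l)) *\<^sub>M \<rho> l))"
  have I: "(1 / (2 * pi)) *\<^sub>R (LINT x:{-N..N}|lborel. exp (\<i> * of_real (t * x)) *\<^sub>M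
      (matrix_inv (P (\<i> * of_real x)) ** Q (\<i> * of_real x))) = I N t" for N t
    unfolding PQ I_def by (subst truncated_fourier_matrix[OF neg]) simp_all
  have g: "(\<lambda>t. cmat (g t)) \<in> borel_measurable borel" and
    "((\<lambda>N. \<integral>\<^sup>+t. ennreal ((norm (I N t - cmat (g t)))\<^sup>2) \<partial>lborel) \<longlongrightarrow> 0) at_top"
    using ker unfolding mcarma_kernel_def L2_inverse_fourier_def I by blast+
  \<comment> \<open>Fatou's lemma is applied to a sequence, so the cutoff is restricted to natural
    numbers.\<close>
  from filterlim_compose[OF this(2) filterlim_real_sequentially]
  have lim0: "(\<lambda>k. \<integral>\<^sup>+t. ennreal ((norm (I (real k) t - cmat (g t)))\<^sup>2) \<partial>lborel) \<longlonglongrightarrow> 0" .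
  have [measurable]: "(\<lambda>t. (LINT x:{-N..N}|lborel. exp (\<i> * of_real (t * x)) / (\<i> * of_real x - c)) *\<^sub>M A) \<in> borel_measurable borel"
    for N c and A :: "complex^'d^'d"
  proof -
    have "(\<lambda>t. LINT x:{-N..N}|lborel. exp (\<i> * of_real (t * x)) / (\<i> * of_real x - c)) \<in> borel_measurable borel"
      unfolding set_lebesgue_integral_def by measurable
    then show ?thesis
      by (rule measurable_compose[OF _ borel_measurable_continuous_onI])
        (intro linear_continuous_on bounded_linear_mat_scale_left)
  qed
  have [measurable]: "I N \<in> borel_measurable borel" for N
    unfolding I_def by measurable
  note g [measurable]
  have "(\<integral>\<^sup>+t. liminf (\<lambda>k. ennreal ((norm (I (real k) t - cmat (g t)))\<^sup>2)) \<partial>lborel)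
      \<le> liminf (\<lambda>k. \<integral>\<^sup>+t. ennreal ((norm (I (real k) t - cmat (g t)))\<^sup>2) \<partial>lborel)"
    by (rule nn_integral_liminf) measurable
  also have "\<dots> = 0" using lim0 by (intro lim_imp_Liminf) auto
  finally have "AE t in lborel. liminf (\<lambda>k. ennreal ((norm (I (real k) t - cmat (g t)))\<^sup>2)) = 0"
    by (subst (asm) le_zero_eq, subst (asm) nn_integral_0_iff_AE) auto
  then show ?thesis
  proof eventually_elim
    case (elim t)
    show ?case
    proof
      assume t: "t > 0"
      let ?G = "\<Sum>l=1..n. exp (lam l * of_real t) *\<^sub>M \<rho> l"
      have "(\<lambda>k. I (real k) t) \<longlonglongrightarrow> (1 / (2 * pi)) *\<^sub>R (\<Sum>l=1..n. (2 * pi * exp (lam l * of_real t)) *\<^sub>M \<rho> l)"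
        unfolding I_def
      proof (intro tendsto_intros bounded_linear.tendsto[OF bounded_linear_mat_scale_left])
        fix l assume "l \<in> {1..n}"
        from truncated_fourier_limit[OF neg[OF this], of t] t
        show "(\<lambda>k. LINT x:{- real k..real k}|lborel. exp (\<i> * of_real (t * x)) / (\<i> * of_real x - lam l)) \<longlonglongrightarrow>
          2 * pi * exp (lam l * of_real t)" by simp
      qed
      also have "(1 / (2 * pi)) *\<^sub>R (\<Sum>l=1..n. (2 * pi * exp (lam l * of_real t)) *\<^sub>M \<rho> l) = ?G"
        by (simp add: mat_scale_def vec_eq_iff scaleR_conv_of_real[where 'a=complex] sum_distrib_left)
      finally have "(\<lambda>k. ennreal ((norm (I (real k) t - cmat (g t)))\<^sup>2)) \<longlonglongrightarrow> ennreal ((norm (?G - cmat (g t)))\<^sup>2)"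
        by (intro tendsto_intros)
      then have "liminf (\<lambda>k. ennreal ((norm (I (real k) t - cmat (g t)))\<^sup>2)) = ennreal ((norm (?G - cmat (g t)))\<^sup>2)"
        by (intro lim_imp_Liminf) auto
      then show "cmat (g t) = ?G" using elim by (simp add: ennreal_eq_0_iff)
    qed
  qed
qed

lemma AE_lborel_translate:
  assumes "AE x in lborel. P (x::real)"
  shows "AE x in lborel. P (c + x)"
proof -
  have "AE x in distr lborel borel ((+) c). P x"
    using assms by (simp only: lborel_distr_plus)
  then show ?thesis by (rule AE_distrD[rotated]) simp
qed

text \<open>With \<open>v = - x\<close> and \<open>t >= 0\<close> the two indicators reduce to
  \<open>v >= 0\<close>, where the kernels at \<open>t + v\<close> and \<open>v\<close> are sums of
  exponentials. Multiplying out leaves integrals of \<open>exp((lam a + lam b) v)\<close> over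
  \<open>v > 0\<close>, which give the denominators.\<close>

lemma kernel_correlation:
  fixes \<rho> :: "nat \<Rightarrow> complex^'d^'d" and g :: "real \<Rightarrow> real^'d^'d"
  assumes g: "AE t in lborel. t > 0 \<longrightarrow> cmat (g t) = (\<Sum>l=1..n. exp (lam l * of_real t) *\<^sub>M \<rho> l)"
    and gm: "g \<in> borel_measurable borel"
    and neg: "\<And>l. l \<in> {1..n} \<Longrightarrow> Re (lam l) < 0" and t: "0 \<le> t"
  shows "complex_of_real (\<integral>x. (indicat_real {..t} x *\<^sub>R g (t - x)) $ i $ k * (indicat_real {..0} x *\<^sub>R g (0 - x)) $ j $ l \<partial>lborel) =
    (\<Sum>a=1..n. \<Sum>b=1..n. exp (lam a * of_real t) * \<rho> a $ i $ k * \<rho> b $ j $ l * (1 / (- lam a - lam b)))"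
proof -
  have gm' [measurable]: "(\<lambda>x. g x $ i $ k) \<in> borel_measurable borel" for i k
    by (intro borel_measurable_vec_nth gm)
  let ?H = "\<lambda>x. (indicat_real {..t} x *\<^sub>R g (t - x)) $ i $ k * (indicat_real {..0} x *\<^sub>R g (0 - x)) $ j $ l"
  have nz: "Re (lam a + lam b) < 0" if "a \<in> {1..n}" "b \<in> {1..n}" for a b
    using neg[OF that(1)] neg[OF that(2)] by simp
  have "(\<integral>x. ?H x \<partial>lborel) = (\<integral>v. ?H (0 + (- 1) * v) \<partial>lborel)"
    by (subst lborel_integral_real_affine[of "- 1" _ 0]) auto
  then have "complex_of_real (\<integral>x. ?H x \<partial>lborel) = (\<integral>v. complex_of_real (?H (- v)) \<partial>lborel)"
    by (simp only: integral_complex_of_real mult_minus1 add_0)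
  also have "\<dots> = (\<integral>v. (\<Sum>a=1..n. \<Sum>b=1..n. (exp (lam a * of_real t) * \<rho> a $ i $ k * \<rho> b $ j $ l) *
      (indicator {0<..} v *\<^sub>R exp ((lam a + lam b) * of_real v))) \<partial>lborel)"
  proof (rule integral_cong_AE)
    show "AE v in lborel. complex_of_real (?H (- v)) = (\<Sum>a=1..n. \<Sum>b=1..n. (exp (lam a * of_real t) * \<rho> a $ i $ k * \<rho> b $ j $ l) *
      (indicator {0<..} v *\<^sub>R exp ((lam a + lam b) * of_real v)))"
      \<comment> \<open>Three null sets are removed: the exceptional set of the kernel at
        \<open>v\<close>, its translate for the kernel at \<open>t + v\<close>, and the endpoint
        \<open>v = 0\<close>, where the indicators on the two sides differ.\<close>
      using g AE_lborel_translate[OF g, of t] AE_lborel_singleton[of 0]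
    proof eventually_elim
      case (elim v)
      show ?case
      proof (cases "v > 0")
        case True
        have e: "complex_of_real (g s $ i $ k) = (\<Sum>a=1..n. exp (lam a * of_real s) * \<rho> a $ i $ k)"
          if "cmat (g s) = (\<Sum>l=1..n. exp (lam l * of_real s) *\<^sub>M \<rho> l)" for s i k
        proof -
          have "cmat (g s) $ i $ k = (\<Sum>l=1..n. exp (lam l * of_real s) *\<^sub>M \<rho> l) $ i $ k" using that by simp
          then show ?thesis by (simp add: mat_scale_def)
        qed
        have "complex_of_real (?H (- v)) = of_real (g (t + v) $ i $ k) * of_real (g v $ j $ l)"
          using True t by simp
        also have "\<dots> = (\<Sum>a=1..n. exp (lam a * of_real (t + v)) * \<rho> a $ i $ k) * (\<Sum>b=1..n. exp (lam b * of_real v) * \<rho> b $ j $ l)"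
          using elim True t by (simp add: e)
        also have "\<dots> = (\<Sum>a=1..n. \<Sum>b=1..n. (exp (lam a * of_real t) * \<rho> a $ i $ k * \<rho> b $ j $ l) *
            (indicator {0<..} v *\<^sub>R exp ((lam a + lam b) * of_real v)))"
          unfolding sum_product using True
          by (intro sum.cong refl) (simp add: distrib_left distrib_right exp_add)
        finally show ?thesis .
      next
        case False
        then show ?thesis using elim by simp
      qed
    qed
    show "(\<lambda>v. complex_of_real (?H (- v))) \<in> borel_measurable lborel"
      unfolding vector_scaleR_component by measurable
    have "(\<lambda>v. c * (indicat_real {0<..} v *\<^sub>R exp (d * complex_of_real v))) \<in> borel_measurable lborel" for c d
      by measurable
    then show "(\<lambda>v. \<Sum>a=1..n. \<Sum>b=1..n. (exp (lam a * of_real t) * \<rho> a $ i $ k * \<rho> b $ j $ l) *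
      (indicat_real {0<..} v *\<^sub>R exp ((lam a + lam b) * of_real v))) \<in> borel_measurable lborel"
      by (intro borel_measurable_sum)
  qed
  also have "\<dots> = (\<Sum>a=1..n. \<Sum>b=1..n. (exp (lam a * of_real t) * \<rho> a $ i $ k * \<rho> b $ j $ l) *
      (\<integral>v. (indicator {0<..} v *\<^sub>R exp ((lam a + lam b) * of_real v)) \<partial>lborel))"
  proof -
    have int: "integrable lborel (\<lambda>v. c * (indicator {0<..} v *\<^sub>R exp ((lam a + lam b) * of_real v)))"
      if "a \<in> {1..n}" "b \<in> {1..n}" for a b and c :: complex
      using exp_tail_integral(1)[OF nz[OF that], of 0] by (intro integrable_mult_right) (simp add: set_integrable_def)
    let ?f = "\<lambda>a b v. (exp (lam a * of_real t) * \<rho> a $ i $ k * \<rho> b $ j $ l) *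
      (indicator {0<..} v *\<^sub>R exp ((lam a + lam b) * of_real v))"
    have "(\<integral>v. (\<Sum>a=1..n. \<Sum>b=1..n. ?f a b v) \<partial>lborel) = (\<Sum>a=1..n. \<integral>v. (\<Sum>b=1..n. ?f a b v) \<partial>lborel)"
      by (intro Bochner_Integration.integral_sum Bochner_Integration.integrable_sum int)
    also have "\<dots> = (\<Sum>a=1..n. \<Sum>b=1..n. \<integral>v. ?f a b v \<partial>lborel)"
      by (intro sum.cong refl Bochner_Integration.integral_sum int)
    finally show ?thesis by (simp only: integral_mult_right_zero)
  qed
  also have "\<dots> = (\<Sum>a=1..n. \<Sum>b=1..n. exp (lam a * of_real t) * \<rho> a $ i $ k * \<rho> b $ j $ l * (1 / (- lam a - lam b)))"
  proof (intro sum.cong refl arg_cong2[of _ _ _ _ times])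
    fix a b assume "a \<in> {1..n}" "b \<in> {1..n}"
    from exp_tail_integral(2)[OF nz[OF this], of 0]
    show "(\<integral>v. (indicator {0<..} v *\<^sub>R exp ((lam a + lam b) * of_real v)) \<partial>lborel) = 1 / (- lam a - lam b)"
      by (simp add: set_lebesgue_integral_def minus_divide_right)
  qed
  finally show ?thesis .
qed

context levy_pair
begin

lemma cov_commute: "cov i j = cov j i"
  by (simp add: cov_def mult.commute)

lemma autocov_mcarma:
  assumes Y: "\<And>t. has_L2_integral M L (\<lambda>s. indicat_real {..t} s *\<^sub>R g (t - s)) (Y t)"
    and g: "AE t in lborel. t > 0 \<longrightarrow> cmat (g t) = (\<Sum>l=1..n. exp (lam l * of_real t) *\<^sub>M \<rho> l)"
    and gm: "g \<in> borel_measurable borel"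
    and neg: "\<And>l. l \<in> {1..n} \<Longrightarrow> Re (lam l) < 0" and t: "0 \<le> t"
  shows "complex_of_real (autocov M Y t $ i $ j) = (\<Sum>a=1..n. exp (lam a * of_real t) * spectral_residue lam n \<rho> (\<chi> i j. cov i j) a $ i $ j)"
    and "autocov M Y (- t) $ i $ j = autocov M Y t $ j $ i"
proof -
  let ?J = "\<lambda>t i k j l. \<integral>x. (indicat_real {..t} x *\<^sub>R g (t - x)) $ i $ k * (indicat_real {..0} x *\<^sub>R g (0 - x)) $ j $ l \<partial>lborel"
  have ac: "autocov M Y t $ i $ j = (\<Sum>k\<in>UNIV. \<Sum>l\<in>UNIV. cov k l * ?J t i k j l)" for t i j
    using L2_integral_isometry(1)[OF Y[of t] Y[of 0], of i j] by (simp add: autocov_def)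
  have "complex_of_real (autocov M Y t $ i $ j) = (\<Sum>k\<in>UNIV. \<Sum>l\<in>UNIV. of_real (cov k l) * (\<Sum>a=1..n. \<Sum>b=1..n.
      exp (lam a * of_real t) * \<rho> a $ i $ k * \<rho> b $ j $ l * (1 / (- lam a - lam b))))"
    unfolding ac of_real_sum of_real_mult
    by (intro sum.cong refl arg_cong2[of _ _ _ _ times] kernel_correlation[OF g gm _ t] neg)
  also have "\<dots> = (\<Sum>a=1..n. \<Sum>b=1..n. \<Sum>k\<in>UNIV. \<Sum>l\<in>UNIV. of_real (cov k l) *
      (exp (lam a * of_real t) * \<rho> a $ i $ k * \<rho> b $ j $ l * (1 / (- lam a - lam b))))"
    unfolding sum_distrib_left
    by (simp only: sum.swap[of _ "{1..n}" "UNIV :: 'd set"])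
  also have "\<dots> = (\<Sum>a=1..n. exp (lam a * of_real t) * spectral_residue lam n \<rho> (\<chi> i j. cov i j) a $ i $ j)"
    by (simp add: spectral_residue_def sandwich_nth mat_scale_def sum_distrib_left mult_ac)
  finally show "complex_of_real (autocov M Y t $ i $ j) = (\<Sum>a=1..n. exp (lam a * of_real t) * spectral_residue lam n \<rho> (\<chi> i j. cov i j) a $ i $ j)" .
  \<comment> \<open>Translating the variable by \<open>- t\<close> interchanges the two kernel
    factors; with the symmetry of \<open>cov\<close> this becomes transposition.\<close>
  have J: "?J (- t) i k j l = ?J t j l i k" for i k j l
    by (subst lborel_integral_real_affine[of 1 _ "- t"]) (auto simp: indicator_def algebra_simps intro!: Bochner_Integration.integral_cong)
  show "autocov M Y (- t) $ i $ j = autocov M Y t $ j $ i"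
    unfolding ac J by (subst sum.swap) (simp add: cov_commute)
qed

end


section \<open>The spectral density of the sampled process\<close>

theorem proposition2:
  fixes M :: "'w measure"
    and L1 L2 Y :: "real \<Rightarrow> 'w \<Rightarrow> real^'d"
    and p q :: nat
    and A B :: "nat \<Rightarrow> real^'d^'d"
    and lam :: "nat \<Rightarrow> complex"
  defines "P \<equiv> ar_poly p A"
    and "Q \<equiv> ma_poly q B"
    and "\<Sigma> \<equiv> covariance_matrix M (L1 1)"
    and "n \<equiv> p * CARD('d)"
  assumes "prob_space M"
    and "levy_process M L1" and "levy_process M L2"
    and "iid_processes M L1 L2"
    and "(\<integral>w. L1 1 w \<partial>M) = 0"
    and "integrable M (\<lambda>w. (norm (L1 1 w))\<^sup>2)"
    and "q < p"
    and "\<And>z. det (P z) = 0 \<Longrightarrow> Re z < 0"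
    and "mcarma_process M (two_sided L1 L2) P Q Y"
    and "bij_betw lam {1..n} {z. det (P z) = 0}"
  shows "(\<exists>\<alpha> \<beta>. partial_fractions P Q \<Sigma> n lam \<alpha> \<beta>) \<and>
    (\<forall>\<alpha> \<beta>. partial_fractions P Q \<Sigma> n lam \<alpha> \<beta> \<longrightarrow>
      (\<forall>\<Delta>>0. \<forall>\<omega>\<in>{-pi<..<pi}.
        sampled_spectral_density M Y \<Delta> \<omega> =
          complex_of_real (1 / (4 * pi)) *\<^sub>M
          (\<Sum>l = 1..n.
            (1 / (cosh (complex_of_real \<Delta> * lam l) - complex_of_real (cos \<omega>))) *\<^sub>M
            (exp (- \<i> * complex_of_real \<omega>) *\<^sub>M (\<alpha> l - transpose (\<alpha> l))
             - exp (complex_of_real \<Delta> * lam l) *\<^sub>M \<alpha> l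
             + exp (- complex_of_real \<Delta> * lam l) *\<^sub>M transpose (\<alpha> l)))))"
proof -
  note prob = assms(5) and levy1 = assms(6) and levy2 = assms(7) and iid = assms(8) and mean = assms(9)
    and second = assms(10) and qp = assms(11) and stable = assms(12) and mcarma = assms(13) and zeros = assms(14)
  interpret L1: levy M L1 using prob levy1 by (simp add: levy_def levy_axioms_def)
  have sq1: "square_integrable M (\<lambda>w. L1 1 w $ i)" for i
    unfolding square_integrable_def
  proof (intro conjI L1.measurable_levy_nth Bochner_Integration.integrable_bound[OF second])
    show "(\<lambda>w. (L1 1 w $ i)\<^sup>2) \<in> borel_measurable M"
      by (intro borel_measurable_power L1.measurable_levy_nth) simp
    show "AE w in M. norm ((L1 1 w $ i)\<^sup>2) \<le> norm ((norm (L1 1 w))\<^sup>2)"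
      using component_le_norm_cart by (auto intro!: AE_I2 simp: abs_le_square_iff[symmetric])
  qed simp
  \<comment> \<open>A vector integral is 0 by default for non-integrable functions, so integrability
    is derived from the second moment before the hypothesis is read componentwise.\<close>
  have mean1: "(\<integral>w. L1 1 w $ i \<partial>M) = 0" for i
  proof -
    have "integrable M (L1 1)"
    proof (rule Bochner_Integration.integrable_bound)
      show "integrable M (\<lambda>w. 1 + (norm (L1 1 w))\<^sup>2)" using second by simp
      have "x \<le> 1 + x\<^sup>2" for x :: real
        using zero_le_power2[of "x - 1 / 2"] by (simp add: power2_eq_square algebra_simps)
      then show "AE w in M. norm (L1 1 w) \<le> norm (1 + (norm (L1 1 w))\<^sup>2)" by simp
    qed (use L1.measurable_levy[of 1] in simp)
    from integral_bounded_linear[OF bounded_linear_vec_nth this, of i] mean show ?thesis by simp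
  qed
  interpret levy_pair M L1 L2
  proof (intro levy_pair.intro centered_levy.intro centered_levy_axioms.intro levy_pair_axioms.intro)
    show "levy M L1" ..
    show "levy M L2" using prob levy2 by (simp add: levy_def levy_axioms_def)
  qed (fact sq1 mean1 iid)+
  have \<Sigma>: "\<Sigma> = (\<chi> i j. cov i j)"
    by (simp add: \<Sigma>_def covariance_matrix_def cov_def mean1 vec_eq_iff)
  have img: "lam ` {1..n} = {z. det (P z) = 0}" using zeros by (simp add: bij_betw_def)
  have neg: "Re (lam l) < 0" if "l \<in> {1..n}" for l
    using img that by (intro stable) blast
  have zero: "det (P (lam l)) = 0" if "l \<in> {1..n}" for l
    using img that by blast
  from mcarma_partial_fractions[OF qp zeros[unfolded P_def n_def], of B, folded P_def Q_def n_def]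
  obtain \<rho> where \<rho>: "\<And>z. det (P z) \<noteq> 0 \<Longrightarrow> matrix_inv (P z) ** Q z = (\<Sum>l=1..n. (1 / (z - lam l)) *\<^sub>M \<rho> l)"
    by blast
  let ?\<alpha> = "spectral_residue lam n \<rho> \<Sigma>"
  have pf: "\<exists>\<beta>. partial_fractions P Q \<Sigma> n lam ?\<alpha> \<beta>"
    by (rule exI, rule partial_fractions_spectral_residue[OF \<rho> zero neg])
  obtain g where ker: "mcarma_kernel P Q g" and
    Y: "\<And>t. has_L2_integral M L (\<lambda>s. indicat_real {..t} s *\<^sub>R g (t - s)) (Y t)"
    using mcarma unfolding mcarma_process_def by blast
  have gm: "g \<in> borel_measurable borel"
  proof -
    have "(\<lambda>t. cmat (g t)) \<in> borel_measurable borel"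
      using ker by (simp add: mcarma_kernel_def L2_inverse_fourier_def)
    then have "(\<lambda>t. \<chi> i j. Re (cmat (g t) $ i $ j)) \<in> borel_measurable borel"
      by (rule measurable_compose[OF _ borel_measurable_continuous_onI])
        (intro continuous_intros)
    then show ?thesis by simp
  qed
  have PQ: "matrix_inv (P (\<i> * of_real x)) ** Q (\<i> * of_real x) = (\<Sum>l=1..n. (1 / (\<i> * of_real x - lam l)) *\<^sub>M \<rho> l)" for x :: real
    using stable[of "\<i> * of_real x"] by (intro \<rho>) auto
  have g: "AE t in lborel. t > 0 \<longrightarrow> cmat (g t) = (\<Sum>l=1..n. exp (lam l * of_real t) *\<^sub>M \<rho> l)"
    using ker PQ neg by (rule mcarma_kernel_AE)
  note ac = autocov_mcarma[where lam = lam and n = n and \<rho> = \<rho>, OF Y g gm, folded \<Sigma>]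
  have ac_pos: "complex_of_real (autocov M Y t $ i $ j) = (\<Sum>a=1..n. ?\<alpha> a $ i $ j * exp (of_real t * lam a))"
    if "0 \<le> t" for t i j
    using ac(1)[OF neg that] by (simp add: mult.commute)
  have ac_neg: "complex_of_real (autocov M Y t $ i $ j) = (\<Sum>a=1..n. ?\<alpha> a $ j $ i * exp (of_real (- t) * lam a))"
    if "t < 0" for t i j
    using ac(2)[OF neg, of "- t" i j] ac_pos[of "- t" j i] that by simp
  have sym: "(\<Sum>a=1..n. ?\<alpha> a $ i $ j) = (\<Sum>a=1..n. ?\<alpha> a $ j $ i)" for i j
    using ac_pos[of 0 i j] ac_pos[of 0 j i] by (simp add: autocov_def mult.commute)
  have main: "sampled_spectral_density M Y \<Delta> \<omega> =
      complex_of_real (1 / (4 * pi)) *\<^sub>M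
      (\<Sum>l = 1..n.
        (1 / (cosh (complex_of_real \<Delta> * lam l) - complex_of_real (cos \<omega>))) *\<^sub>M
        (exp (- \<i> * complex_of_real \<omega>) *\<^sub>M (\<alpha> l - transpose (\<alpha> l))
         - exp (complex_of_real \<Delta> * lam l) *\<^sub>M \<alpha> l
         + exp (- complex_of_real \<Delta> * lam l) *\<^sub>M transpose (\<alpha> l)))" (is "_ = _ *\<^sub>M ?S")
    if \<Delta>: "0 < \<Delta>" and \<alpha>: "\<And>l. l \<in> {1..n} \<Longrightarrow> \<alpha> l = ?\<alpha> l" for \<Delta> \<omega> \<alpha>
  proof -
    have "((\<lambda>k::int. exp (- \<i> * of_int k * complex_of_real \<omega>) *\<^sub>M cmat (autocov M Y (of_int k * \<Delta>))) has_sum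
        (1 / 2) *\<^sub>M ?S) UNIV"
    proof (intro has_sum_vec)
      fix i j
      have entry: "complex_of_real (autocov M Y (of_int k * \<Delta>) $ i $ j) =
          (if k \<ge> 0 then \<Sum>l=1..n. ?\<alpha> l $ i $ j * exp (of_real (of_int k * \<Delta>) * lam l)
           else \<Sum>l=1..n. ?\<alpha> l $ j $ i * exp (of_real (- of_int k * \<Delta>) * lam l))" for k :: int
        using \<Delta> ac_pos[of "of_int k * \<Delta>" i j] ac_neg[of "of_int k * \<Delta>" i j]
        by (simp add: mult_neg_pos)
      have S: "((1 / 2) *\<^sub>M ?S) $ i $ j = (1 / 2) * (\<Sum>l=1..n. (1 / (cosh (of_real \<Delta> * lam l) - of_real (cos \<omega>))) *
        (exp (- \<i> * of_real \<omega>) * (?\<alpha> l $ i $ j - ?\<alpha> l $ j $ i) - exp (of_real \<Delta> * lam l) * ?\<alpha> l $ i $ j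
          + exp (- of_real \<Delta> * lam l) * ?\<alpha> l $ j $ i))"
        by (simp add: mat_scale_def transpose_def \<alpha>)
      show "((\<lambda>k::int. (exp (- \<i> * of_int k * complex_of_real \<omega>) *\<^sub>M cmat (autocov M Y (of_int k * \<Delta>))) $ i $ j) has_sum
          ((1 / 2) *\<^sub>M ?S) $ i $ j) UNIV"
        using sampled_geometric_series[where a = "\<lambda>l. ?\<alpha> l $ i $ j" and b = "\<lambda>l. ?\<alpha> l $ j $ i", OF neg \<Delta> sym]
        unfolding S by (simp add: mat_scale_def entry)
    qed
    then have "sampled_spectral_density M Y \<Delta> \<omega> = complex_of_real (1 / (2 * pi)) *\<^sub>M (1 / 2) *\<^sub>M ?S"
      unfolding sampled_spectral_density_def by (simp only: infsumI)
    then show ?thesis by (simp add: mat_scale_mat_scale)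
  qed
  show ?thesis
  proof (intro conjI allI impI ballI)
    show "\<exists>\<alpha> \<beta>. partial_fractions P Q \<Sigma> n lam \<alpha> \<beta>" using pf by blast
    fix \<alpha> \<beta> and \<Delta> \<omega> :: real
    assume pf': "partial_fractions P Q \<Sigma> n lam \<alpha> \<beta>" and "0 < \<Delta>"
    obtain \<beta>' where "partial_fractions P Q \<Sigma> n lam ?\<alpha> \<beta>'" using pf by blast
    then have "\<alpha> l = ?\<alpha> l" if "l \<in> {1..n}" for l
      by (rule partial_fractions_unique[OF pf' _ zeros stable that])
    with \<open>0 < \<Delta>\<close> show "sampled_spectral_density M Y \<Delta> \<omega> =
      complex_of_real (1 / (4 * pi)) *\<^sub>M
      (\<Sum>l = 1..n.
        (1 / (cosh (complex_of_real \<Delta> * lam l) - complex_of_real (cos \<omega>))) *\<^sub>M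
        (exp (- \<i> * complex_of_real \<omega>) *\<^sub>M (\<alpha> l - transpose (\<alpha> l))
         - exp (complex_of_real \<Delta> * lam l) *\<^sub>M \<alpha> l
         + exp (- complex_of_real \<Delta> * lam l) *\<^sub>M transpose (\<alpha> l)))"
      by (rule main)
  qed
qed

end
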